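(* Let $G$ be a group, let $A$ be an abelian group regarded as a trivial $G$-module, and let $n\ge 1$ be an integer. Then there is a short exact sequence $$0 \longrightarrow \mathrm{Ext}^1_{\mathbb Z}\bigl(H_{n-1}(G,\mathbb Z),A\bigr)\ \xrightarrow{\ \iota\ }\ \mathrm{Utw}^{n}(G,A)\ \xrightarrow{\ \tilde{\varrho}\ }\ \mathrm{Hom}\bigl(H_{0n}(G,\mathbb Z),A\bigr)\longrightarrow 0,$$ where $H_{0n}(G,\mathbb Z)$ is the quotient of $H_n(G,\mathbb Z)$ defined as $H_{0n}(G,\mathbb Z)=Z_n/(Z_{0n}+B_n)$, with $$Z_{0n}=\Bigl\langle \sum_{\sigma\in S_n}\mathrm{sgn}(\sigma)\,[g_{\sigma(1)}|\dots|g_{\sigma(n)}]\ \Big|\ (g_1,\dots,g_n)\in X_n(G)\Bigr\rangle .$$ This short exact sequence splits (non-canonically).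
   Context: Notation. $X_n(G)=\{(g_1,\dots,g_n)\in G^n\mid g_ig_j=g_jg_i\text{ for all }i,j\}$ is the set of commuting $n$-tuples, and $S_n$ is the symmetric group on $n$ letters. Let $F_\bullet\to\mathbb Z$ be the normalized bar resolution of $\mathbb Z$ as a left $\mathbb ZG$-module and put $C_\bullet=\mathbb Z\otimes_{\mathbb ZG}F_\bullet$ (so $C_0=\mathbb Z$). The element $1\otimes[g_1|\cdots|g_n]$ of $C_n$ is denoted $[g_1|\cdots|g_n]$; it is zero if some $g_i=1$. The differential $\partial_n:C_n\to C_{n-1}$ is $$\partial_n[g_1|\dots|g_n]=[g_2|\dots|g_n]+\sum_{i=1}^{n-1}(-1)^i[g_1|\dots|g_ig_{i+1}|\dots|g_n]+(-1)^n[g_1|\dots|g_{n-1}].$$ Put $Z_n=\ker\partial_n$, $B_n=\mathrm{im}\,\partial_{n+1}$, $H_n(G,\mathbb Z)=Z_n/B_n$. (The subgroup $Z_{0n}$ of $C_n$ is contained in $Z_n$.) With $A$ written additively, $\partial_{n+1}$ induces $\delta^n:\mathrm{Hom}(C_n,A)\to\mathrm{Hom}(C_{n+1},A)$, and $H^n(G,A)=\ker\delta^n/\mathrm{im}\,\delta^{n-1}$. For $\omega\in\ker\delta^n$, write $\omega(g_1,\dots,g_n)=\omega([g_1|\dots|g_n])$. Define $$\mathrm{Utw}^n(G,A)=\Bigl\{[\omega]\in H^n(G,A)\ \Big|\ \sum_{\sigma\in S_n}\mathrm{sgn}(\sigma)\,\omega(g_{\sigma(1)},\dots,g_{\sigma(n)})=0\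 \text{for all }(g_1,\dots,g_n)\in X_n(G)\Bigr\}.$$ The maps. The Universal Coefficient Theorem gives a short exact sequence $0\to\mathrm{Ext}^1_{\mathbb Z}(H_{n-1}(G,\mathbb Z),A)\xrightarrow{\iota}H^n(G,A)\xrightarrow{\varrho}\mathrm{Hom}(H_n(G,\mathbb Z),A)\to0$. Here $\varrho([\omega])(z+B_n)=\omega(z)$ for $z\in Z_n$. Identifying $\mathrm{Ext}^1_{\mathbb Z}(H_{n-1}(G,\mathbb Z),A)$ with the cokernel of the restriction map $\mathrm{res}:\mathrm{Hom}(Z_{n-1},A)\to\mathrm{Hom}(B_{n-1},A)$, one has $\iota(\varphi+\mathrm{im}\,\mathrm{res})=[\varphi\partial_n]$. The map $\iota$ in the claim is this map $\iota$, with target $\mathrm{Utw}^n(G,A)\subseteq H^n(G,A)$, and $\tilde\varrho$ is the map induced by $\varrho$, that is, $\tilde\varrho([\omega])(z+Z_{0n}+B_n)=\omega(z)$ for $[\omega]\in\mathrm{Utw}^n(G,A)$ and $z\in Z_n$. *)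

theory Defs
  imports "HOL-Algebra.Free_Abelian_Groups" "HOL-Combinatorics.Permutations"
begin

section \<open>Homomorphism groups, cokernels and \<open>Ext\<close>\<close>

(* The group Hom(H,A) for abelian A, written multiplicatively.  Its elements are extensional,
   so that two of them are equal as HOL functions iff they agree on the carrier of H. *)
definition hom_group ::
  "('h, 'm) monoid_scheme \<Rightarrow> ('a, 'k) monoid_scheme \<Rightarrow> ('h \<Rightarrow> 'a) monoid"
  where "hom_group H A =
    \<lparr>carrier = hom H A \<inter> extensional (carrier H),
     monoid.mult = (\<lambda>f g. \<lambda>x\<in>carrier H. f x \<otimes>\<^bsub>A\<^esub> g x),
     one = (\<lambda>x\<in>carrier H. \<one>\<^bsub>A\<^esub>)\<rparr>"

definition res_image ::
  "('p, 'm) monoid_scheme \<Rightarrow> 'p set \<Rightarrow> ('a, 'k) monoid_scheme \<Rightarrow> ('p \<Rightarrow> 'a) set"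
  where "res_image P K A = (\<lambda>\<psi>. restrict \<psi> K) ` carrier (hom_group P A)"

(* The cokernel of the restriction map Hom(P,A) -> Hom(K,A) for a subgroup K of P. *)
definition res_coker ::
  "('p, 'm) monoid_scheme \<Rightarrow> 'p set \<Rightarrow> ('a, 'k) monoid_scheme \<Rightarrow> ('p \<Rightarrow> 'a) set monoid"
  where "res_coker P K A = hom_group (P\<lparr>carrier := K\<rparr>) A Mod res_image P K A"

(* The canonical epimorphism onto an abelian group M from the free abelian group on the set M. *)
definition free_eval :: "('h, 'm) monoid_scheme \<Rightarrow> ('h \<Rightarrow>\<^sub>0 int) \<Rightarrow> 'h"
  where "free_eval M c = (\<Otimes>\<^bsub>M\<^esub>x\<in>Poly_Mapping.keys c. x [^]\<^bsub>M\<^esub> Poly_Mapping.lookup c x)"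

(* Ext^1 over the integers, computed from the canonical free resolution 0 -> K -> F -> M -> 0,
   where F is the free abelian group on the set M and K is the kernel of evaluation. *)
definition Ext1 ::
  "('h, 'm) monoid_scheme \<Rightarrow> ('a, 'k) monoid_scheme \<Rightarrow> (('h \<Rightarrow>\<^sub>0 int) \<Rightarrow> 'a) set monoid"
  where "Ext1 M A =
    res_coker (free_Abelian_group (carrier M))
      (kernel (free_Abelian_group (carrier M)) M (free_eval M)) A"

(* For any presentation P/K with P free abelian: a morphism of resolutions over the identity of
   P/K, from 0 -> K -> P -> P/K -> 0 to the canonical one.  It exists because P is free. *)
definition resolution_lift ::
  "('p, 'm) monoid_scheme \<Rightarrow> 'p set \<Rightarrow> 'p \<Rightarrow> ('p set \<Rightarrow>\<^sub>0 int)"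
  where "resolution_lift P K =
    (SOME t. t \<in> hom P (free_Abelian_group (carrier (P Mod K))) \<and>
       (\<forall>x\<in>carrier P. free_eval (P Mod K) (t x) = K #>\<^bsub>P\<^esub> x))"

(* The canonical identification of Ext^1(P/K,A) with coker(Hom(P,A) -> Hom(K,A)): pullback along
   the morphism of resolutions.  Lifts are unique up to maps from P to the kernel of evaluation,
   so the induced map on classes does not depend on the choice above.
   Here and below, the_elem (f ` X) is the common value of f on the coset X. *)
definition Ext1_ident ::
  "('p, 'm) monoid_scheme \<Rightarrow> 'p set \<Rightarrow> ('a, 'k) monoid_scheme
    \<Rightarrow> (('p set \<Rightarrow>\<^sub>0 int) \<Rightarrow> 'a) set \<Rightarrow> ('p \<Rightarrow> 'a) set"
  where "Ext1_ident P K A X =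
    the_elem ((\<lambda>\<psi>. res_image P K A #>\<^bsub>hom_group (P\<lparr>carrier := K\<rparr>) A\<^esub>
                 (\<lambda>x\<in>K. \<psi> (resolution_lift P K x))) ` X)"


section \<open>The normalized bar complex and group homology\<close>

(* C_n: the normalized bar resolution is ZG-free on the symbols [g_1|...|g_n] with all g_i
   different from 1, so tensoring with the trivial module Z gives the free abelian group on them. *)
definition bar_chains :: "('g, 'm) monoid_scheme \<Rightarrow> nat \<Rightarrow> ('g list \<Rightarrow>\<^sub>0 int) monoid"
  where "bar_chains G n =
    free_Abelian_group {gs. length gs = n \<and> set gs \<subseteq> carrier G - {\<one>\<^bsub>G\<^esub>}}"

(* The element [g_1|...|g_n]. *)
definition bar :: "('g, 'm) monoid_scheme \<Rightarrow> 'g list \<Rightarrow> ('g list \<Rightarrow>\<^sub>0 int)"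
  where "bar G gs = (if \<one>\<^bsub>G\<^esub> \<in> set gs then 0 else frag_of gs)"

(* [g_1,...,g_n] becomes [g_1,...,g_i g_{i+1},...,g_n]; i counts from 1, list positions from 0. *)
definition merge_at :: "('g, 'm) monoid_scheme \<Rightarrow> nat \<Rightarrow> 'g list \<Rightarrow> 'g list"
  where "merge_at G i gs = take (i - 1) gs @ (gs ! (i - 1) \<otimes>\<^bsub>G\<^esub> gs ! i) # drop (i + 1) gs"

definition bar_boundary_gen :: "('g, 'm) monoid_scheme \<Rightarrow> 'g list \<Rightarrow> ('g list \<Rightarrow>\<^sub>0 int)"
  where "bar_boundary_gen G gs =
    bar G (tl gs)
    + (\<Sum>i\<in>{1..<length gs}. frag_cmul ((-1) ^ i) (bar G (merge_at G i gs)))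
    + frag_cmul ((-1) ^ length gs) (bar G (butlast gs))"

(* The differential C_n -> C_{n-1}, with value 0 on C_0. *)
definition bar_boundary ::
  "('g, 'm) monoid_scheme \<Rightarrow> nat \<Rightarrow> ('g list \<Rightarrow>\<^sub>0 int) \<Rightarrow> ('g list \<Rightarrow>\<^sub>0 int)"
  where "bar_boundary G n c = (if n = 0 then 0 else frag_extend (bar_boundary_gen G) c)"

definition bar_cycles :: "('g, 'm) monoid_scheme \<Rightarrow> nat \<Rightarrow> ('g list \<Rightarrow>\<^sub>0 int) set"
  where "bar_cycles G n = kernel (bar_chains G n) (bar_chains G (n - 1)) (bar_boundary G n)"

definition bar_boundaries :: "('g, 'm) monoid_scheme \<Rightarrow> nat \<Rightarrow> ('g list \<Rightarrow>\<^sub>0 int) set"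
  where "bar_boundaries G n = bar_boundary G (n + 1) ` carrier (bar_chains G (n + 1))"

definition cycle_group :: "('g, 'm) monoid_scheme \<Rightarrow> nat \<Rightarrow> ('g list \<Rightarrow>\<^sub>0 int) monoid"
  where "cycle_group G n = (bar_chains G n)\<lparr>carrier := bar_cycles G n\<rparr>"

definition group_homology :: "('g, 'm) monoid_scheme \<Rightarrow> nat \<Rightarrow> ('g list \<Rightarrow>\<^sub>0 int) set monoid"
  where "group_homology G n = cycle_group G n Mod bar_boundaries G n"

definition commuting_tuples :: "('g, 'm) monoid_scheme \<Rightarrow> nat \<Rightarrow> 'g list set"
  where "commuting_tuples G n =
    {gs. length gs = n \<and> set gs \<subseteq> carrier G \<and>
         (\<forall>i<n. \<forall>j<n. gs ! i \<otimes>\<^bsub>G\<^esub> gs ! j = gs ! j \<otimes>\<^bsub>G\<^esub> gs ! i)}"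

definition Z0n :: "('g, 'm) monoid_scheme \<Rightarrow> nat \<Rightarrow> ('g list \<Rightarrow>\<^sub>0 int) set"
  where "Z0n G n = generate (bar_chains G n)
    {(\<Sum>\<sigma> | \<sigma> permutes {..<n}. frag_cmul (sign \<sigma>) (bar G (permute_list \<sigma> gs))) | gs.
       gs \<in> commuting_tuples G n}"

definition H0n :: "('g, 'm) monoid_scheme \<Rightarrow> nat \<Rightarrow> ('g list \<Rightarrow>\<^sub>0 int) set monoid"
  where "H0n G n = cycle_group G n Mod (Z0n G n <#>\<^bsub>bar_chains G n\<^esub> bar_boundaries G n)"


section \<open>Group cohomology with trivial coefficients\<close>

definition cochains ::
  "('g, 'm) monoid_scheme \<Rightarrow> ('a, 'k) monoid_scheme \<Rightarrow> nat \<Rightarrow> (('g list \<Rightarrow>\<^sub>0 int) \<Rightarrow> 'a) monoid"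
  where "cochains G A n = hom_group (bar_chains G n) A"

definition coboundary ::
  "('g, 'm) monoid_scheme \<Rightarrow> nat
    \<Rightarrow> (('g list \<Rightarrow>\<^sub>0 int) \<Rightarrow> 'a) \<Rightarrow> (('g list \<Rightarrow>\<^sub>0 int) \<Rightarrow> 'a)"
  where "coboundary G n \<omega> = (\<lambda>c\<in>carrier (bar_chains G (n + 1)). \<omega> (bar_boundary G (n + 1) c))"

definition cocycles ::
  "('g, 'm) monoid_scheme \<Rightarrow> ('a, 'k) monoid_scheme \<Rightarrow> nat \<Rightarrow> (('g list \<Rightarrow>\<^sub>0 int) \<Rightarrow> 'a) set"
  where "cocycles G A n = kernel (cochains G A n) (cochains G A (n + 1)) (coboundary G n)"

definition coboundaries ::
  "('g, 'm) monoid_scheme \<Rightarrow> ('a, 'k) monoid_scheme \<Rightarrow> nat \<Rightarrow> (('g list \<Rightarrow>\<^sub>0 int) \<Rightarrow> 'a) set"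
  where "coboundaries G A n =
    (if n = 0 then {\<one>\<^bsub>cochains G A 0\<^esub>}
     else coboundary G (n - 1) ` carrier (cochains G A (n - 1)))"

definition group_cohomology ::
  "('g, 'm) monoid_scheme \<Rightarrow> ('a, 'k) monoid_scheme \<Rightarrow> nat
    \<Rightarrow> (('g list \<Rightarrow>\<^sub>0 int) \<Rightarrow> 'a) set monoid"
  where "group_cohomology G A n =
    (cochains G A n)\<lparr>carrier := cocycles G A n\<rparr> Mod coboundaries G A n"

definition cohomology_class ::
  "('g, 'm) monoid_scheme \<Rightarrow> ('a, 'k) monoid_scheme \<Rightarrow> nat
    \<Rightarrow> (('g list \<Rightarrow>\<^sub>0 int) \<Rightarrow> 'a) \<Rightarrow> (('g list \<Rightarrow>\<^sub>0 int) \<Rightarrow> 'a) set"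
  where "cohomology_class G A n \<omega> = coboundaries G A n #>\<^bsub>cochains G A n\<^esub> \<omega>"

(* The alternating sum over all permutations, in the multiplicative notation for A. *)
definition Utw ::
  "('g, 'm) monoid_scheme \<Rightarrow> ('a, 'k) monoid_scheme \<Rightarrow> nat
    \<Rightarrow> (('g list \<Rightarrow>\<^sub>0 int) \<Rightarrow> 'a) set monoid"
  where "Utw G A n = (group_cohomology G A n)\<lparr>carrier :=
    {cohomology_class G A n \<omega> | \<omega>. \<omega> \<in> cocycles G A n \<and>
       (\<forall>gs\<in>commuting_tuples G n.
          (\<Otimes>\<^bsub>A\<^esub>\<sigma>\<in>{\<sigma>. \<sigma> permutes {..<n}}.
             \<omega> (bar G (permute_list \<sigma> gs)) [^]\<^bsub>A\<^esub> sign \<sigma>) = \<one>\<^bsub>A\<^esub>)}\<rparr>"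


section \<open>The maps and exactness\<close>

(* On the cokernel of Hom(Z_{n-1},A) -> Hom(B_{n-1},A), sending the class of \<phi> to the class of
   \<phi> composed with the n-th differential. *)
definition iota_coker ::
  "('g, 'm) monoid_scheme \<Rightarrow> ('a, 'k) monoid_scheme \<Rightarrow> nat
    \<Rightarrow> (('g list \<Rightarrow>\<^sub>0 int) \<Rightarrow> 'a) set \<Rightarrow> (('g list \<Rightarrow>\<^sub>0 int) \<Rightarrow> 'a) set"
  where "iota_coker G A n X =
    the_elem ((\<lambda>\<phi>. cohomology_class G A n
                 (\<lambda>c\<in>carrier (bar_chains G n). \<phi> (bar_boundary G n c))) ` X)"

definition iota ::
  "('g, 'm) monoid_scheme \<Rightarrow> ('a, 'k) monoid_scheme \<Rightarrow> nat
    \<Rightarrow> ((('g list \<Rightarrow>\<^sub>0 int) set \<Rightarrow>\<^sub>0 int) \<Rightarrow> 'a) set \<Rightarrow> (('g list \<Rightarrow>\<^sub>0 int) \<Rightarrow> 'a) set"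
  where "iota G A n =
    iota_coker G A n \<circ> Ext1_ident (cycle_group G (n - 1)) (bar_boundaries G (n - 1)) A"

definition rho_tilde ::
  "('g, 'm) monoid_scheme \<Rightarrow> nat
    \<Rightarrow> (('g list \<Rightarrow>\<^sub>0 int) \<Rightarrow> 'a) set \<Rightarrow> (('g list \<Rightarrow>\<^sub>0 int) set \<Rightarrow> 'a)"
  where "rho_tilde G n X = (\<lambda>Y\<in>carrier (H0n G n). the_elem {\<omega> z | \<omega> z. \<omega> \<in> X \<and> z \<in> Y})"

(* The library's short_exact_sequence requires all groups to have the same element type. *)
definition short_exact ::
  "('x, 'm) monoid_scheme \<Rightarrow> ('y, 'k) monoid_scheme \<Rightarrow> ('z, 'l) monoid_scheme
    \<Rightarrow> ('x \<Rightarrow> 'y) \<Rightarrow> ('y \<Rightarrow> 'z) \<Rightarrow> bool"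
  where "short_exact X Y Z f g \<longleftrightarrow>
    comm_group X \<and> comm_group Y \<and> comm_group Z \<and>
    f \<in> mon X Y \<and> g \<in> epi Y Z \<and> f ` carrier X = kernel Y Z g"

definition has_section ::
  "('y, 'k) monoid_scheme \<Rightarrow> ('z, 'l) monoid_scheme \<Rightarrow> ('y \<Rightarrow> 'z) \<Rightarrow> bool"
  where "has_section Y Z g \<longleftrightarrow> (\<exists>s\<in>hom Z Y. \<forall>z\<in>carrier Z. g (s z) = z)"

end

theory Submission
  imports Defs
begin

text \<open>Let \<open>C\<^sub>n\<close> be the normalized bar complex with cycles \<open>Z\<^sub>n\<close> and boundaries \<open>B\<^sub>n\<close>. The group \<open>B\<^sub>n\<^sub>-\<^sub>1 = \<partial> C\<^sub>n\<close> is a subgroup of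
a free abelian group, hence projective (\<open>subgroup_free_Abelian_group_projective\<close>). So \<open>\<partial> : C\<^sub>n \<rightarrow> B\<^sub>n\<^sub>-\<^sub>1\<close> has
a section \<open>s\<close>, and \<open>c \<mapsto> c - s (\<partial> c)\<close> retracts \<open>C\<^sub>n\<close> onto \<open>Z\<^sub>n\<close> (\<open>boundary_splitting\<close>). The argument
rests on this splitting of \<open>C\<^sub>n\<close> into \<open>Z\<^sub>n\<close> and a copy of \<open>B\<^sub>n\<^sub>-\<^sub>1\<close>.

By additivity, the condition that defines \<open>Utw\<close> says that the cocycle kills \<open>Z0n\<close>. It depends only on
the class, because \<open>Z0n\<close> consists of cycles (\<open>bar_boundary_antisymmetrized\<close>): in the boundary of an antisymmetrized
commuting tuple the inner faces cancel in pairs under the transposition of the two merged entries, and the first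
face cancels the last one under a cyclic shift.

Hence a homomorphism on \<open>H0n\<close>, pulled back along \<open>C\<^sub>n \<rightarrow> Z\<^sub>n \<rightarrow> H0n\<close>, is a cocycle with class in \<open>Utw\<close>. This
defines a homomorphism that is right inverse to \<open>rho_tilde\<close>, which yields surjectivity and the splitting
at the same time (\<open>rho_tilde_has_section\<close>). A class in the kernel of \<open>rho_tilde\<close> is represented by a cocycle
that kills \<open>Z\<^sub>n\<close>; such a cocycle has the form \<open>\<phi> \<circ> \<partial>\<close> with \<open>\<phi>\<close> on \<open>B\<^sub>n\<^sub>-\<^sub>1\<close>, and it is a coboundary exactly if
\<open>\<phi>\<close> extends to \<open>Z\<^sub>n\<^sub>-\<^sub>1\<close> (\<open>iota_coker_exact\<close>). So the kernel is the cokernel of the restriction from \<open>Z\<^sub>n\<^sub>-\<^sub>1\<close> to \<open>B\<^sub>n\<^sub>-\<^sub>1\<close>,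
which the comparison with the canonical free presentation of \<open>H\<^sub>n\<^sub>-\<^sub>1\<close> identifies with \<open>Ext\<close>
(\<open>Ext1_ident_iso\<close>).\<close>

section \<open>Subgroups of free abelian groups are projective\<close>

text \<open>An additive relation between a free abelian group and an abelian group contains the graph of a
homomorphism on its whole domain. Phrasing the lifting problem for a relation \<open>R\<close> makes all
partial solutions subgroups of one ambient group, so that no partial functions have to be handled.

Zorn's lemma is applied to the subgroups \<open>\<Gamma> \<subseteq> R\<close> that are graphs of homomorphisms and whose domain
contains every element of \<open>Domain R\<close> supported on the basis vectors \<open>T \<Gamma>\<close> used by the domain. Let \<open>M\<close> be
a maximal one and suppose that its domain is too small. Take \<open>h\<close> outside with as few new basis vectors as
possible, and let \<open>a\<close> be one of these. The elements \<open>Q\<close> of \<open>Domain R\<close> that are supported on \<open>T M\<close> and the support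
of \<open>h\<close> have \<open>a\<close>-coefficients that form a nonzero ideal of the integers, generated by the
coefficient of some \<open>h0\<close>; and those with coefficient zero use fewer new basis vectors, so they lie in the
domain of \<open>M\<close>. Hence \<open>Q\<close> is the direct sum of the domain of \<open>M\<close> and the multiples of \<open>h0\<close>, and
any partner of \<open>h0\<close> under \<open>R\<close> extends \<open>M\<close>.\<close>

theorem additive_relation_section:
  fixes R :: "(('s \<Rightarrow>\<^sub>0 int) \<times> 'e) set" and E :: "('e, 'k) monoid_scheme"
  assumes E: "comm_group E" and R: "subgroup R (free_Abelian_group S \<times>\<times> E)"
  obtains t where "t \<in> hom ((free_Abelian_group S)\<lparr>carrier := Domain R\<rparr>) E"
    and "\<And>x. x \<in> Domain R \<Longrightarrow> (x, t x) \<in> R"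
proof -
  interpret E: comm_group E by fact
  let ?F = "free_Abelian_group S"
  define D where "D = ?F \<times>\<times> E"
  interpret F: comm_group ?F
    by (rule abelian_free_Abelian_group)
  interpret D: comm_group D
    unfolding D_def
    by (rule group.group_comm_groupI)
      (auto simp: DirProd_group E.is_group F.m_comm E.m_comm add.commute)
  have mult_D [simp]: "(x, y) \<otimes>\<^bsub>D\<^esub> (x', y') = (x + x', y \<otimes>\<^bsub>E\<^esub> y')" for x x' y y'
    by (simp add: D_def)
  have one_D: "\<one>\<^bsub>D\<^esub> = (0, \<one>\<^bsub>E\<^esub>)"
    by (simp add: D_def)
  interpret R: subgroup R D
    using R by (simp add: D_def)
  have R_carrier: "Poly_Mapping.keys x \<subseteq> S" "y \<in> carrier E" if "(x, y) \<in> R" for x y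
    using subsetD[OF R.subset that] by (simp_all add: D_def)
  have inv_D: "inv\<^bsub>D\<^esub> (x, y) = (- x, inv\<^bsub>E\<^esub> y)" if "(x, y) \<in> R" for x y
    using R_carrier[OF that] by (simp add: D_def E.is_group)
  have fst_pow: "fst (z [^]\<^bsub>D\<^esub> k) = frag_cmul k (fst z)" if "z \<in> R" for z and k :: int
  proof -
    have "fst \<in> hom D ?F"
      by (rule homI) (auto simp: D_def)
    then have "fst (z [^]\<^bsub>D\<^esub> k) = fst z [^]\<^bsub>?F\<^esub> k"
      using that R.subset by (intro hom_int_pow) (auto simp: D.is_group)
    then show ?thesis
      using R_carrier(1)[of "fst z" "snd z"] that by simp
  qed
  have pow_R: "z [^]\<^bsub>D\<^esub> k \<in> R" if "z \<in> R" for z and k :: int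
    using D.subgroup_int_pow_closed[OF R.subgroup_axioms that] .
  have dom_diff: "x - frag_cmul k h \<in> Domain R" if "x \<in> Domain R" "h \<in> Domain R" for x h k
  proof -
    obtain y e where ye: "(x, y) \<in> R" "(h, e) \<in> R"
      using \<open>x \<in> Domain R\<close> \<open>h \<in> Domain R\<close> by (meson DomainE)
    have "(x, y) \<otimes>\<^bsub>D\<^esub> (h, e) [^]\<^bsub>D\<^esub> (- k) \<in> R"
      using ye pow_R by blast
    moreover have "fst ((x, y) \<otimes>\<^bsub>D\<^esub> (h, e) [^]\<^bsub>D\<^esub> (- k)) = x - frag_cmul k h"
      using fst_pow[OF ye(2), of "- k"] by (cases "(h, e) [^]\<^bsub>D\<^esub> (- k)") (simp flip: minus_frag_cmul)
    ultimately show ?thesis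
      by (metis Domain.DomainI prod.collapse)
  qed
  define T where "T = (\<lambda>\<Gamma> :: (('s \<Rightarrow>\<^sub>0 int) \<times> 'e) set. \<Union>(Poly_Mapping.keys ` Domain \<Gamma>))"
  define \<G> where "\<G> = {\<Gamma>. subgroup \<Gamma> D \<and> \<Gamma> \<subseteq> R \<and> (\<forall>y. (0, y) \<in> \<Gamma> \<longrightarrow> y = \<one>\<^bsub>E\<^esub>)
    \<and> (\<forall>x \<in> Domain R. Poly_Mapping.keys x \<subseteq> T \<Gamma> \<longrightarrow> x \<in> Domain \<Gamma>)}"
  have "\<exists>M\<in>\<G>. \<forall>X\<in>\<G>. M \<subseteq> X \<longrightarrow> X = M"
  proof (rule subset_Zorn_nonempty)
    have "{\<one>\<^bsub>D\<^esub>} \<in> \<G>"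
      using D.triv_subgroup R.one_closed by (auto simp: \<G>_def T_def one_D)
    then show "\<G> \<noteq> {}"
      by blast
  next
    fix \<C> assume ne: "\<C> \<noteq> {}" and chain: "subset.chain \<G> \<C>"
    then have \<C>: "\<C> \<subseteq> \<G>" and total: "\<And>X Y. X \<in> \<C> \<Longrightarrow> Y \<in> \<C> \<Longrightarrow> X \<subseteq> Y \<or> Y \<subseteq> X"
      by (auto simp: subset_chain_def)
    have sub: "subgroup X D" and le: "X \<subseteq> R"
      and zero: "(0, y) \<in> X \<Longrightarrow> y = \<one>\<^bsub>E\<^esub>" 
      and full: "x \<in> Domain R \<Longrightarrow> Poly_Mapping.keys x \<subseteq> T X \<Longrightarrow> x \<in> Domain X"
      if "X \<in> \<C>" for X x y
      using subsetD[OF \<C> that] by (simp_all add: \<G>_def)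
    have "subgroup (\<Union>\<C>) D"
    proof
      show "\<Union>\<C> \<subseteq> carrier D"
        using le R.subset by (meson Sup_least subset_trans)
      show "\<one>\<^bsub>D\<^esub> \<in> \<Union>\<C>"
        using ne sub subgroup.one_closed by fast
      show "inv\<^bsub>D\<^esub> z \<in> \<Union>\<C>" if "z \<in> \<Union>\<C>" for z
        using that sub subgroup.m_inv_closed by fast
      show "z \<otimes>\<^bsub>D\<^esub> w \<in> \<Union>\<C>" if "z \<in> \<Union>\<C>" "w \<in> \<Union>\<C>" for z w
      proof -
        obtain X where "X \<in> \<C>" "z \<in> X" "w \<in> X"
          using \<open>z \<in> \<Union>\<C>\<close> \<open>w \<in> \<Union>\<C>\<close> total by (meson UnionE subsetD)
        then show ?thesis
          using sub subgroup.m_closed by fast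
      qed
    qed
    moreover have "x \<in> Domain (\<Union>\<C>)" if x: "x \<in> Domain R" "Poly_Mapping.keys x \<subseteq> T (\<Union>\<C>)" for x
    proof -
      have "Poly_Mapping.keys x \<subseteq> \<Union>(T ` \<C>)"
        using x(2) unfolding T_def Domain_Union by blast
      moreover have "subset.chain UNIV (T ` \<C>)"
      proof -
        have mono: "T X \<subseteq> T Y" if "X \<subseteq> Y" for X Y
          unfolding T_def by (intro Union_mono image_mono Domain_mono that)
        have "A \<subseteq> B \<or> B \<subseteq> A" if AB: "A \<in> T ` \<C>" "B \<in> T ` \<C>" for A B
        proof -
          obtain X Y where "X \<in> \<C>" "Y \<in> \<C>" "A = T X" "B = T Y"
            using AB by auto
          then show ?thesis
            using total[of X Y] mono[of X Y] mono[of Y X] by auto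
        qed
        then show ?thesis
          by (simp add: subset_chain_def)
      qed
      ultimately obtain Y where "Y \<in> T ` \<C>" "Poly_Mapping.keys x \<subseteq> Y"
        using finite_subset_Union_chain[OF finite_keys, of x "T ` \<C>" UNIV] ne by blast
      then obtain X where "X \<in> \<C>" "Poly_Mapping.keys x \<subseteq> T X"
        by blast
      then have "x \<in> Domain X"
        using full x(1) by blast
      then show ?thesis
        using \<open>X \<in> \<C>\<close> by blast
    qed
    moreover have "\<Union>\<C> \<subseteq> R" "\<forall>y. (0, y) \<in> \<Union>\<C> \<longrightarrow> y = \<one>\<^bsub>E\<^esub>"
      using le zero by blast+
    ultimately show "\<Union>\<C> \<in> \<G>"
      unfolding \<G>_def by blast
  qed
  then obtain M where M: "M \<in> \<G>" and max: "\<And>X. X \<in> \<G> \<Longrightarrow> M \<subseteq> X \<Longrightarrow> X = M"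
    by blast
  interpret M: subgroup M D
    using M by (simp add: \<G>_def)
  have M_R: "M \<subseteq> R" and M_0: "\<And>y. (0, y) \<in> M \<Longrightarrow> y = \<one>\<^bsub>E\<^esub>"
    and M_full: "\<And>x. x \<in> Domain R \<Longrightarrow> Poly_Mapping.keys x \<subseteq> T M \<Longrightarrow> x \<in> Domain M"
    using M by (auto simp: \<G>_def)
  have M_keys: "Poly_Mapping.keys x \<subseteq> T M" if "(x, y) \<in> M" for x y
    using that by (auto simp: T_def)
  have dom: "Domain M = Domain R"
  proof (rule ccontr)
    assume "Domain M \<noteq> Domain R"
    then obtain h1 where "h1 \<in> Domain R - Domain M"
      using M_R by blast
    then obtain h where h: "h \<in> Domain R" "h \<notin> Domain M" and least: "\<And>x. x \<in> Domain R - Domain M \<Longrightarrow>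
        card (Poly_Mapping.keys h - T M) \<le> card (Poly_Mapping.keys x - T M)"
      using ex_has_least_nat[of "\<lambda>x. x \<in> Domain R - Domain M" h1 "\<lambda>x. card (Poly_Mapping.keys x - T M)"]
      by blast
    then obtain a where a: "a \<in> Poly_Mapping.keys h" "a \<notin> T M"
      using M_full by blast
    define Q where "Q = {x \<in> Domain R. Poly_Mapping.keys x \<subseteq> T M \<union> Poly_Mapping.keys h}"
    have Q_M: "x \<in> Domain M" if "x \<in> Q" "Poly_Mapping.lookup x a = 0" for x
    proof (rule ccontr)
      assume "x \<notin> Domain M"
      have "a \<notin> Poly_Mapping.keys x"
        using that(2) by (simp add: in_keys_iff)
      then have "Poly_Mapping.keys x - T M \<subset> Poly_Mapping.keys h - T M"
        using that(1) a unfolding Q_def by blast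
      then have "card (Poly_Mapping.keys x - T M) < card (Poly_Mapping.keys h - T M)"
        by (rule psubset_card_mono[rotated]) simp
      then show False
        using least[of x] that(1) \<open>x \<notin> Domain M\<close> unfolding Q_def by auto
    qed
    have Q_diff: "x - frag_cmul k w \<in> Q" if "x \<in> Q" "w \<in> Q" for x w k
      using that dom_diff keys_diff[of x "frag_cmul k w"] keys_cmul[of k w] unfolding Q_def by blast
    have "h \<in> Q" "0 \<in> Q"
      using h R.one_closed by (auto simp: Q_def one_D)
    then have "h \<in> Q \<and> 0 - frag_cmul 1 h \<in> Q"
      using Q_diff by blast
    moreover have "Poly_Mapping.lookup h a \<noteq> 0"
      using a(1) by (simp add: in_keys_iff)
    ultimately have "\<exists>x. x \<in> Q \<and> 0 < Poly_Mapping.lookup x a"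
      by (cases "0 < Poly_Mapping.lookup h a") (auto intro: exI[of _ h] exI[of _ "- h"])
    then obtain h0 where h0: "h0 \<in> Q" "0 < Poly_Mapping.lookup h0 a"
      and h0_least: "\<And>x. x \<in> Q \<Longrightarrow> 0 < Poly_Mapping.lookup x a \<Longrightarrow>
         nat (Poly_Mapping.lookup h0 a) \<le> nat (Poly_Mapping.lookup x a)"
      using ex_has_least_nat[of "\<lambda>x. x \<in> Q \<and> 0 < Poly_Mapping.lookup x a" _ "\<lambda>x. nat (Poly_Mapping.lookup x a)"]
      by blast
    define d where "d = Poly_Mapping.lookup h0 a"
    \<comment> \<open>division with remainder by the least positive coefficient\<close>
    have reduce: "x - frag_cmul (Poly_Mapping.lookup x a div d) h0 \<in> Domain M" if "x \<in> Q" for x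
    proof (rule Q_M)
      let ?r = "x - frag_cmul (Poly_Mapping.lookup x a div d) h0"
      show r: "?r \<in> Q"
        using Q_diff that h0(1) by blast
      have "Poly_Mapping.lookup ?r a = Poly_Mapping.lookup x a mod d"
        by (simp add: lookup_minus d_def minus_div_mult_eq_mod)
      then have "0 \<le> Poly_Mapping.lookup ?r a" "Poly_Mapping.lookup ?r a < d"
        using h0(2) by (simp_all add: d_def)
      then show "Poly_Mapping.lookup ?r a = 0"
        using h0_least[OF r] unfolding d_def by linarith
    qed
    obtain e0 where z: "(h0, e0) \<in> R"
      using h0(1) unfolding Q_def by blast
    let ?z = "(h0, e0)"
    \<comment> \<open>the graph extended by sending \<open>h0\<close> to \<open>e0\<close>\<close>
    define M' where "M' = M <#>\<^bsub>D\<^esub> range (\<lambda>k::int. ?z [^]\<^bsub>D\<^esub> k)"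
    have M'I: "w \<otimes>\<^bsub>D\<^esub> ?z [^]\<^bsub>D\<^esub> k \<in> M'" if "w \<in> M" for w and k :: int
      using that by (auto simp: M'_def set_mult_def)
    have M'E: "\<exists>w\<in>M. \<exists>k::int. v = w \<otimes>\<^bsub>D\<^esub> ?z [^]\<^bsub>D\<^esub> k" if "v \<in> M'" for v
      using that by (auto simp: M'_def set_mult_def)
    have fst_M': "fst (w \<otimes>\<^bsub>D\<^esub> ?z [^]\<^bsub>D\<^esub> k) = fst w + frag_cmul k h0" for w and k :: int
      using fst_pow[OF z, of k] by (cases w; cases "?z [^]\<^bsub>D\<^esub> k") simp
    have carr: "?z \<in> carrier D"
      using z R.subset by blast
    have "subgroup M' D"
      unfolding M'_def
      by (intro D.mult_subgroups M.subgroup_axioms D.subgroup_of_powers carr)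
    moreover have "M' \<subseteq> R"
      using M'E M_R pow_R[OF z] R.m_closed by blast
    moreover have "y = \<one>\<^bsub>E\<^esub>" if "(0, y) \<in> M'" for y
    proof -
      obtain w k where w: "w \<in> M" "(0, y) = w \<otimes>\<^bsub>D\<^esub> ?z [^]\<^bsub>D\<^esub> (k::int)"
        using M'E \<open>(0, y) \<in> M'\<close> by blast
      have "0 = fst w + frag_cmul k h0"
        using fst_M'[of w k] by (simp flip: w(2))
      then have "Poly_Mapping.lookup (fst w + frag_cmul k h0) a = 0"
        by simp
      moreover have "Poly_Mapping.lookup (fst w) a = 0"
        using M_keys[of "fst w" "snd w"] w(1) a(2) by (auto simp: in_keys_iff)
      ultimately have "k = 0"
        using h0(2) by (simp add: lookup_add)
      then show ?thesis
        using w M_0 by auto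
    qed
    moreover have "x \<in> Domain M'" if x: "x \<in> Domain R" "Poly_Mapping.keys x \<subseteq> T M'" for x
    proof -
      have "T M' \<subseteq> T M \<union> Poly_Mapping.keys h"
      proof -
        have "Poly_Mapping.keys (fst v) \<subseteq> T M \<union> Poly_Mapping.keys h" if v: "v \<in> M'" for v
        proof -
          obtain w k where w: "w \<in> M" "v = w \<otimes>\<^bsub>D\<^esub> ?z [^]\<^bsub>D\<^esub> (k::int)"
            using M'E v by blast
          have "Poly_Mapping.keys (fst v) \<subseteq> Poly_Mapping.keys (fst w) \<union> Poly_Mapping.keys (frag_cmul k h0)"
            unfolding w(2) fst_M' by (rule keys_add)
          moreover have "Poly_Mapping.keys (frag_cmul k h0) \<subseteq> T M \<union> Poly_Mapping.keys h"
            using h0(1) keys_cmul[of k h0] unfolding Q_def by blast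
          ultimately show ?thesis
            using M_keys[of "fst w" "snd w"] w(1) by auto
        qed
        then show ?thesis
          unfolding T_def by force
      qed
      then have "x \<in> Q"
        using x unfolding Q_def by blast
      then obtain y where "(x - frag_cmul (Poly_Mapping.lookup x a div d) h0, y) \<in> M"
        using reduce by blast
      from M'I[OF this, of "Poly_Mapping.lookup x a div d"]
        fst_M'[of "(x - frag_cmul (Poly_Mapping.lookup x a div d) h0, y)" "Poly_Mapping.lookup x a div d"]
      show ?thesis
        by (metis Domain.DomainI diff_add_cancel fst_conv prod.collapse)
    qed
    ultimately have "M' \<in> \<G>"
      unfolding \<G>_def by blast
    moreover have "M \<subseteq> M'"
    proof
      fix w assume "w \<in> M"
      then show "w \<in> M'"
        using M'I[of w 0] M.subset by auto
    qed
    ultimately have "M' = M"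
      by (rule max)
    moreover have "?z \<in> M'"
      using M'I[OF M.one_closed, of 1] carr by simp
    ultimately have "a \<in> T M"
      using M_keys[of h0 e0] h0(2) by (auto simp: in_keys_iff)
    with a(2) show False
      by contradiction
  qed
  define t where "t x = (SOME y. (x, y) \<in> M)" for x
  have t_M: "(x, t x) \<in> M" if "x \<in> Domain R" for x
    using that unfolding dom[symmetric] t_def by (metis Domain.cases someI_ex)
  have unique: "y = y'" if "(x, y) \<in> M" "(x, y') \<in> M" for x y y'
  proof -
    have "(x, y) \<otimes>\<^bsub>D\<^esub> inv\<^bsub>D\<^esub> (x, y') \<in> M"
      using that by blast
    then have "y \<otimes>\<^bsub>E\<^esub> inv\<^bsub>E\<^esub> y' = \<one>\<^bsub>E\<^esub>"
      using that(2) M_R M_0 by (auto simp: inv_D)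
    then show ?thesis
      using that M_R R_carrier(2) E.inv_equality E.inv_inv E.inv_closed by (metis subsetD)
  qed
  show thesis
  proof
    show "t \<in> hom (?F\<lparr>carrier := Domain R\<rparr>) E"
    proof (rule homI)
      show "t x \<in> carrier E" if "x \<in> carrier (?F\<lparr>carrier := Domain R\<rparr>)" for x
        using t_M[of x] M_R R_carrier(2) that by auto
      fix x y assume "x \<in> carrier (?F\<lparr>carrier := Domain R\<rparr>)" "y \<in> carrier (?F\<lparr>carrier := Domain R\<rparr>)"
      then have "(x, t x) \<in> M" "(y, t y) \<in> M"
        by (simp_all add: t_M)
      then have "(x + y, t x \<otimes>\<^bsub>E\<^esub> t y) \<in> M"
        using M.m_closed by fastforce
      then have "t (x + y) = t x \<otimes>\<^bsub>E\<^esub> t y"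
        using t_M unique dom by blast
      then show "t (x \<otimes>\<^bsub>?F\<lparr>carrier := Domain R\<rparr>\<^esub> y) = t x \<otimes>\<^bsub>E\<^esub> t y"
        by simp
    qed
    show "(x, t x) \<in> R" if "x \<in> Domain R" for x
      using t_M[OF that] M_R by blast
  qed
qed

text \<open>The lifts of \<open>f\<close> through \<open>p\<close> are the homomorphisms whose graph lies in the fibre product of \<open>f\<close> and \<open>p\<close>,
which is an additive relation with domain \<open>H\<close>.\<close>

theorem subgroup_free_Abelian_group_projective:
  assumes H: "subgroup H (free_Abelian_group S)" and E: "comm_group E" and M: "group M"
    and p: "p \<in> hom E M" and f: "f \<in> hom ((free_Abelian_group S)\<lparr>carrier := H\<rparr>) M"
    and onto: "f ` H \<subseteq> p ` carrier E"
  obtains t where "t \<in> hom ((free_Abelian_group S)\<lparr>carrier := H\<rparr>) E"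
    and "\<And>x. x \<in> H \<Longrightarrow> p (t x) = f x"
proof -
  interpret E: comm_group E by fact
  interpret M: group M by fact
  interpret H: subgroup H "free_Abelian_group S" by fact
  let ?P = "(free_Abelian_group S)\<lparr>carrier := H\<rparr>"
  interpret P: group ?P
    by (rule H.subgroup_is_group) simp
  interpret p: group_hom E M p
    by unfold_locales (rule p)
  interpret f: group_hom ?P M f
    by unfold_locales (rule f)
  define R where "R = {(x, y). x \<in> H \<and> y \<in> carrier E \<and> p y = f x}"
  have inv_P: "inv\<^bsub>?P\<^esub> x = - x" if "x \<in> H" for x
    using that H.subset by (subst group.m_inv_consistent[OF group_free_Abelian_group H]) auto
  have "subgroup R (free_Abelian_group S \<times>\<times> E)"
  proof
    show "R \<subseteq> carrier (free_Abelian_group S \<times>\<times> E)"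
      using H.subset by (auto simp: R_def)
    show "\<one>\<^bsub>free_Abelian_group S \<times>\<times> E\<^esub> \<in> R"
      using f.hom_one H.one_closed by (simp add: R_def)
  next
    fix u v assume "u \<in> R" "v \<in> R"
    then show "u \<otimes>\<^bsub>free_Abelian_group S \<times>\<times> E\<^esub> v \<in> R"
      using f.hom_mult H.m_closed by (auto simp: R_def)
  next
    fix u assume u: "u \<in> R"
    then obtain x y where xy: "u = (x, y)" "x \<in> H" "y \<in> carrier E" "p y = f x"
      by (auto simp: R_def)
    then have "Poly_Mapping.keys x \<subseteq> S"
      using subsetD[OF H.subset] by simp
    then have "inv\<^bsub>free_Abelian_group S \<times>\<times> E\<^esub> u = (- x, inv\<^bsub>E\<^esub> y)"
      using xy by (simp add: E.is_group)
    then show "inv\<^bsub>free_Abelian_group S \<times>\<times> E\<^esub> u \<in> R"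
      using xy f.hom_inv[of x] P.inv_closed[of x] by (simp add: R_def inv_P)
  qed
  then obtain t where t: "t \<in> hom ((free_Abelian_group S)\<lparr>carrier := Domain R\<rparr>) E"
    and t_R: "\<And>x. x \<in> Domain R \<Longrightarrow> (x, t x) \<in> R"
    using additive_relation_section[OF E] by blast
  have dom: "Domain R = H"
  proof
    show "H \<subseteq> Domain R"
    proof
      fix x assume x: "x \<in> H"
      then obtain y where "y \<in> carrier E" "f x = p y"
        using onto by blast
      then show "x \<in> Domain R"
        using x by (auto simp: R_def intro!: DomainI[of x y])
    qed
  qed (auto simp: R_def)
  show thesis
  proof
    show "t \<in> hom ?P E"
      using t by (simp add: dom)
    show "p (t x) = f x" if "x \<in> H" for x
      using t_R[of x] that unfolding dom by (simp add: R_def)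
  qed
qed

section \<open>Homomorphism groups and maps induced on quotients\<close>

lemma comm_group_subgroup:
  assumes "comm_group H" "subgroup K H"
  shows "comm_group (H\<lparr>carrier := K\<rparr>)"
proof -
  interpret H: comm_group H by fact
  interpret K: subgroup K H by fact
  show ?thesis
    by (rule group.group_comm_groupI[OF K.subgroup_is_group[OF H.is_group]]) (simp add: H.m_comm)
qed

lemma carrier_hom_group:
  "f \<in> carrier (hom_group H A) \<longleftrightarrow> f \<in> hom H A \<and> f \<in> extensional (carrier H)"
  by (simp add: hom_group_def)

lemma hom_group_mult:
  "x \<in> carrier H \<Longrightarrow> (f \<otimes>\<^bsub>hom_group H A\<^esub> g) x = f x \<otimes>\<^bsub>A\<^esub> g x"
  by (simp add: hom_group_def)

lemma hom_group_one: "x \<in> carrier H \<Longrightarrow> \<one>\<^bsub>hom_group H A\<^esub> x = \<one>\<^bsub>A\<^esub>"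
  by (simp add: hom_group_def)

lemma hom_group_closed:
  "f \<in> carrier (hom_group H A) \<Longrightarrow> x \<in> carrier H \<Longrightarrow> f x \<in> carrier A"
  by (auto simp: carrier_hom_group hom_def)

lemma hom_group_eqI:
  assumes "f \<in> carrier (hom_group H A)" "g \<in> carrier (hom_group H A)"
    and "\<And>x. x \<in> carrier H \<Longrightarrow> f x = g x"
  shows "f = g"
  using assms by (intro extensionalityI[of f "carrier H" g]) (auto simp: carrier_hom_group)

lemma restrict_in_hom_group:
  assumes "group H" "f \<in> hom H A"
  shows "restrict f (carrier H) \<in> carrier (hom_group H A)"
  using assms by (auto simp: carrier_hom_group intro: group.hom_restrict)

lemma comm_group_hom_group:
  assumes H: "group H" and A: "comm_group A"
  shows "comm_group (hom_group H A)"
proof -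
  interpret H: group H by fact
  interpret A: comm_group A by fact
  have closed: "f \<otimes>\<^bsub>hom_group H A\<^esub> g \<in> carrier (hom_group H A)"
    if "f \<in> carrier (hom_group H A)" "g \<in> carrier (hom_group H A)" for f g
  proof -
    have "(\<lambda>x. f x \<otimes>\<^bsub>A\<^esub> g x) \<in> hom H A"
      using that by (auto simp: carrier_hom_group hom_def Pi_iff A.m_ac)
    from restrict_in_hom_group[OF H this] show ?thesis
      by (simp add: hom_group_def)
  qed
  have one: "\<one>\<^bsub>hom_group H A\<^esub> \<in> carrier (hom_group H A)"
    using restrict_in_hom_group[OF H, of "\<lambda>x. \<one>\<^bsub>A\<^esub>" A] by (simp add: hom_group_def hom_def)
  show ?thesis
  proof (rule comm_groupI)
    fix f assume f: "f \<in> carrier (hom_group H A)"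
    have "(\<lambda>x. inv\<^bsub>A\<^esub> f x) \<in> hom H A"
      using f by (auto simp: carrier_hom_group hom_def Pi_iff A.inv_mult)
    from restrict_in_hom_group[OF H this]
    have g: "restrict (\<lambda>x. inv\<^bsub>A\<^esub> f x) (carrier H) \<in> carrier (hom_group H A)" .
    show "\<exists>g\<in>carrier (hom_group H A). g \<otimes>\<^bsub>hom_group H A\<^esub> f = \<one>\<^bsub>hom_group H A\<^esub>"
      by (rule bexI[OF _ g], rule hom_group_eqI[OF closed[OF g f] one])
        (simp add: hom_group_mult hom_group_one hom_group_closed[OF f])
  next
    fix f g h
    assume f: "f \<in> carrier (hom_group H A)" and g: "g \<in> carrier (hom_group H A)"
      and h: "h \<in> carrier (hom_group H A)"
    show "f \<otimes>\<^bsub>hom_group H A\<^esub> g \<otimes>\<^bsub>hom_group H A\<^esub> h = f \<otimes>\<^bsub>hom_group H A\<^esub> (g \<otimes>\<^bsub>hom_group H A\<^esub> h)"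
      by (rule hom_group_eqI[of _ H A]) (use f g h in \<open>auto simp: closed hom_group_mult hom_group_closed A.m_assoc\<close>)
  next
    fix f g assume "f \<in> carrier (hom_group H A)" "g \<in> carrier (hom_group H A)"
    then show "f \<otimes>\<^bsub>hom_group H A\<^esub> g = g \<otimes>\<^bsub>hom_group H A\<^esub> f"
      by (intro hom_group_eqI[of _ H A]) (auto simp: closed hom_group_mult hom_group_closed A.m_comm)
  next
    fix f assume "f \<in> carrier (hom_group H A)"
    then show "\<one>\<^bsub>hom_group H A\<^esub> \<otimes>\<^bsub>hom_group H A\<^esub> f = f"
      by (intro hom_group_eqI[of _ H A]) (auto simp: closed one hom_group_mult hom_group_one hom_group_closed)
  qed (use closed one in auto)
qed

lemma hom_group_inv:
  assumes "group H" "comm_group A" "f \<in> carrier (hom_group H A)" "x \<in> carrier H"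
  shows "(inv\<^bsub>hom_group H A\<^esub> f) x = inv\<^bsub>A\<^esub> f x"
proof -
  interpret A: comm_group A by fact
  interpret X: comm_group "hom_group H A"
    by (rule comm_group_hom_group) fact+
  have "(inv\<^bsub>hom_group H A\<^esub> f \<otimes>\<^bsub>hom_group H A\<^esub> f) x = \<one>\<^bsub>A\<^esub>"
    using assms(3,4) by (simp add: hom_group_one)
  then have "(inv\<^bsub>hom_group H A\<^esub> f) x \<otimes>\<^bsub>A\<^esub> f x = \<one>\<^bsub>A\<^esub>"
    using assms(4) by (simp add: hom_group_mult)
  then show ?thesis
    using assms(3,4) by (metis A.inv_equality X.inv_closed hom_group_closed)
qed

text \<open>Contravariance of \<open>Hom(-, A)\<close>. Coboundary maps, restrictions and the sections constructed below are all
pullbacks of this kind.\<close>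

lemma pullback_hom:
  assumes H: "group H" and t: "t \<in> hom H H'"
  shows "(\<lambda>\<psi>. \<lambda>x\<in>carrier H. \<psi> (t x)) \<in> hom (hom_group H' A) (hom_group H A)"
proof (rule homI)
  interpret H: group H by fact
  have t': "t x \<in> carrier H'" if "x \<in> carrier H" for x
    using t that by (auto simp: hom_def)
  show "(\<lambda>x\<in>carrier H. \<psi> (t x)) \<in> carrier (hom_group H A)" if "\<psi> \<in> carrier (hom_group H' A)" for \<psi>
  proof -
    have "\<psi> \<circ> t \<in> hom H A"
      using that t by (intro hom_compose) (auto simp: carrier_hom_group)
    from restrict_in_hom_group[OF H this] show ?thesis
      by (simp add: o_def)
  qed
  show "(\<lambda>x\<in>carrier H. (\<psi> \<otimes>\<^bsub>hom_group H' A\<^esub> \<psi>') (t x)) =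
    (\<lambda>x\<in>carrier H. \<psi> (t x)) \<otimes>\<^bsub>hom_group H A\<^esub> (\<lambda>x\<in>carrier H. \<psi>' (t x))" for \<psi> \<psi>'
    using t' by (auto simp: fun_eq_iff hom_group_def)
qed

lemma pullback_in_hom_group:
  "\<lbrakk>group H; t \<in> hom H H'; \<psi> \<in> carrier (hom_group H' A)\<rbrakk>
    \<Longrightarrow> (\<lambda>x\<in>carrier H. \<psi> (t x)) \<in> carrier (hom_group H A)"
  using hom_in_carrier[OF pullback_hom] by fast

lemma restrict_in_res_image:
  "\<psi> \<in> carrier (hom_group P A) \<Longrightarrow> restrict \<psi> K \<in> res_image P K A"
  by (simp add: res_image_def)

lemma subgroup_res_image:
  assumes P: "group P" and K: "subgroup K P" and A: "comm_group A"
  shows "subgroup (res_image P K A) (hom_group (P\<lparr>carrier := K\<rparr>) A)"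
proof -
  interpret P: group P by fact
  interpret K: subgroup K P by fact
  have PK: "group (P\<lparr>carrier := K\<rparr>)"
    by (rule K.subgroup_is_group) fact
  have "(\<lambda>x. x) \<in> hom (P\<lparr>carrier := K\<rparr>) P"
    by (auto simp: hom_def)
  from pullback_hom[OF PK this, of A]
  have "(\<lambda>\<psi>. restrict \<psi> K) \<in> hom (hom_group P A) (hom_group (P\<lparr>carrier := K\<rparr>) A)"
    by simp
  moreover have "group (hom_group P A)" "group (hom_group (P\<lparr>carrier := K\<rparr>) A)"
    using comm_group_hom_group[OF P A] comm_group_hom_group[OF PK A] comm_group.axioms(2) by blast+
  ultimately have "group_hom (hom_group P A) (hom_group (P\<lparr>carrier := K\<rparr>) A) (\<lambda>\<psi>. restrict \<psi> K)"
    by (simp add: group_hom_def group_hom_axioms_def)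
  then show ?thesis
    unfolding res_image_def by (rule group_hom.img_is_subgroup)
qed

lemma comm_group_res_coker:
  assumes P: "group P" and K: "subgroup K P" and A: "comm_group A"
  shows "comm_group (res_coker P K A)"
proof -
  have "group (P\<lparr>carrier := K\<rparr>)"
    using K P by (rule subgroup.subgroup_is_group)
  then have "comm_group (hom_group (P\<lparr>carrier := K\<rparr>) A)"
    using A by (rule comm_group_hom_group)
  then show ?thesis
    unfolding res_coker_def using subgroup_res_image[OF P K A] by (rule comm_group.abelian_FactGroup)
qed

text \<open>The identification of \<open>Ext\<close> and the map \<open>iota_coker\<close> are given on a coset as the common value \<open>the_elem (g ` X)\<close>.
The following lemmas provide the homomorphism theorem in this form.\<close>

lemma FactGroup_induced_value:
  assumes "group \<Gamma>" "group \<Delta>" "subgroup N \<Gamma>" "g \<in> hom \<Gamma> \<Delta>"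
    and "\<And>x. x \<in> N \<Longrightarrow> g x = \<one>\<^bsub>\<Delta>\<^esub>" and "x \<in> carrier \<Gamma>"
  shows "the_elem (g ` (N #>\<^bsub>\<Gamma>\<^esub> x)) = g x"
proof -
  interpret \<Gamma>: group \<Gamma> by fact
  interpret \<Delta>: group \<Delta> by fact
  interpret N: subgroup N \<Gamma> by fact
  have "g (m \<otimes>\<^bsub>\<Gamma>\<^esub> x) = g x" if "m \<in> N" for m
    using that assms(4-6) by (simp add: hom_mult hom_in_carrier)
  then have "g ` (N #>\<^bsub>\<Gamma>\<^esub> x) = {g x}"
    using N.one_closed by (auto simp: r_coset_def image_iff intro!: exI[of _ "\<one>\<^bsub>\<Gamma>\<^esub>"])
  then show ?thesis
    by simp
qed

lemma FactGroup_induced_hom: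
  assumes "group \<Gamma>" "group \<Delta>" "N \<lhd> \<Gamma>" "g \<in> hom \<Gamma> \<Delta>"
    and "\<And>x. x \<in> N \<Longrightarrow> g x = \<one>\<^bsub>\<Delta>\<^esub>"
  shows "(\<lambda>X. the_elem (g ` X)) \<in> hom (\<Gamma> Mod N) \<Delta>"
proof (rule homI)
  interpret N: normal N \<Gamma> by fact
  note val = FactGroup_induced_value[OF assms(1,2) N.subgroup_axioms assms(4,5)]
  show "the_elem (g ` X) \<in> carrier \<Delta>" if "X \<in> carrier (\<Gamma> Mod N)" for X
    using that val assms(4) by (auto simp: carrier_FactGroup hom_in_carrier)
  fix X Y assume "X \<in> carrier (\<Gamma> Mod N)" "Y \<in> carrier (\<Gamma> Mod N)"
  then obtain x y where "x \<in> carrier \<Gamma>" "X = N #>\<^bsub>\<Gamma>\<^esub> x" "y \<in> carrier \<Gamma>" "Y = N #>\<^bsub>\<Gamma>\<^esub> y"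
    by (auto simp: carrier_FactGroup)
  then show "the_elem (g ` (X \<otimes>\<^bsub>\<Gamma> Mod N\<^esub> Y)) = the_elem (g ` X) \<otimes>\<^bsub>\<Delta>\<^esub> the_elem (g ` Y)"
    using val assms(4) by (simp add: N.rcos_sum hom_mult)
qed

lemma FactGroup_induced_image:
  assumes "group \<Gamma>" "group \<Delta>" "N \<lhd> \<Gamma>" "g \<in> hom \<Gamma> \<Delta>"
    and "\<And>x. x \<in> N \<Longrightarrow> g x = \<one>\<^bsub>\<Delta>\<^esub>"
  shows "(\<lambda>X. the_elem (g ` X)) ` carrier (\<Gamma> Mod N) = g ` carrier \<Gamma>"
proof -
  interpret N: normal N \<Gamma> by fact
  show ?thesis
    using FactGroup_induced_value[OF assms(1,2) N.subgroup_axioms assms(4,5)]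
    by (simp add: carrier_FactGroup image_image)
qed

lemma FactGroup_induced_mon:
  assumes "group \<Gamma>" "group \<Delta>" "N \<lhd> \<Gamma>" "g \<in> hom \<Gamma> \<Delta>"
    and "\<And>x. x \<in> N \<Longrightarrow> g x = \<one>\<^bsub>\<Delta>\<^esub>"
    and "\<And>x. x \<in> carrier \<Gamma> \<Longrightarrow> g x = \<one>\<^bsub>\<Delta>\<^esub> \<Longrightarrow> x \<in> N"
  shows "(\<lambda>X. the_elem (g ` X)) \<in> mon (\<Gamma> Mod N) \<Delta>"
proof -
  interpret N: normal N \<Gamma> by fact
  have "the_elem (g ` X) = \<one>\<^bsub>\<Delta>\<^esub> \<Longrightarrow> X = N" if "X \<in> carrier (\<Gamma> Mod N)" for X
    using that FactGroup_induced_value[OF assms(1,2) N.subgroup_axioms assms(4,5)] assms(6)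
    by (auto simp: carrier_FactGroup N.rcos_const[OF assms(1)])
  then show ?thesis
    using FactGroup_induced_hom[OF assms(1-5)]
    by (subst mon_iff_hom_one) (auto simp: N.factorgroup_is_group assms(2))
qed

lemma hom_sum_free_Abelian_group:
  assumes A: "comm_group A" and h: "h \<in> hom (free_Abelian_group S) A" and fin: "finite I"
    and x: "\<And>i. i \<in> I \<Longrightarrow> x i \<in> carrier (free_Abelian_group S)"
  shows "h (\<Sum>i\<in>I. x i) = (\<Otimes>\<^bsub>A\<^esub>i\<in>I. h (x i))"
proof -
  interpret A: comm_group A by fact
  interpret h: group_hom "free_Abelian_group S" A h
    by (simp add: group_hom_def group_hom_axioms_def h A.is_group)
  show ?thesis
    using fin x
  proof (induction I rule: finite_induct)
    case empty
    show ?case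
      using h.hom_one by simp
  next
    case (insert i I)
    have "(\<Sum>i\<in>I. x i) \<in> carrier (free_Abelian_group S)"
      by (rule sum_closed_free_Abelian_group) (use insert.prems in auto)
    then have "h (x i + (\<Sum>i\<in>I. x i)) = h (x i) \<otimes>\<^bsub>A\<^esub> h (\<Sum>i\<in>I. x i)"
      using h.hom_mult[of "x i"] insert.prems[of i] by simp
    moreover have "h \<circ> x \<in> insert i I \<rightarrow> carrier A"
      using insert.prems h.hom_closed by auto
    ultimately show ?case
      using insert by (simp add: A.finprod_insert Pi_iff)
  qed
qed

section \<open>Computing Ext from another presentation\<close>

text \<open>A common finite index set for the products of several chains; it is needed because the support of a sum
can be smaller than the supports of the summands.\<close>

lemma free_eval_superset:
  assumes "comm_group M" "finite U" "U \<subseteq> carrier M" "Poly_Mapping.keys c \<subseteq> U"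
  shows "free_eval M c = (\<Otimes>\<^bsub>M\<^esub>x\<in>U. x [^]\<^bsub>M\<^esub> Poly_Mapping.lookup c x)"
proof -
  interpret M: comm_group M by fact
  show ?thesis
    unfolding free_eval_def
    by (rule M.finprod_mono_neutral_cong_left) (use assms in \<open>auto simp: in_keys_iff\<close>)
qed

lemma free_eval_hom:
  assumes "comm_group M"
  shows "free_eval M \<in> hom (free_Abelian_group (carrier M)) M"
proof (rule homI)
  interpret M: comm_group M by fact
  show "free_eval M c \<in> carrier M" if "c \<in> carrier (free_Abelian_group (carrier M))" for c
    using that unfolding free_eval_def by (intro M.finprod_closed) auto
  fix c d
  assume "c \<in> carrier (free_Abelian_group (carrier M))" "d \<in> carrier (free_Abelian_group (carrier M))"
  then have cd: "Poly_Mapping.keys c \<subseteq> carrier M" "Poly_Mapping.keys d \<subseteq> carrier M"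
    by simp_all
  define U where "U = Poly_Mapping.keys c \<union> Poly_Mapping.keys d"
  have U: "finite U" "U \<subseteq> carrier M" "Poly_Mapping.keys c \<subseteq> U" "Poly_Mapping.keys d \<subseteq> U"
    "Poly_Mapping.keys (c + d) \<subseteq> U"
    using cd keys_add[of c d] by (auto simp: U_def)
  have "free_eval M (c + d) =
    (\<Otimes>\<^bsub>M\<^esub>x\<in>U. x [^]\<^bsub>M\<^esub> Poly_Mapping.lookup c x \<otimes>\<^bsub>M\<^esub> x [^]\<^bsub>M\<^esub> Poly_Mapping.lookup d x)"
    unfolding free_eval_superset[OF assms U(1,2,5)] lookup_add
    using U(2) by (intro M.finprod_cong refl) (auto simp: simp_implies_def M.int_pow_mult)
  also have "\<dots> = free_eval M c \<otimes>\<^bsub>M\<^esub> free_eval M d"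
    unfolding free_eval_superset[OF assms U(1,2,3)] free_eval_superset[OF assms U(1,2,4)]
    using U(2) by (intro M.finprod_multf) auto
  finally show "free_eval M (c \<otimes>\<^bsub>free_Abelian_group (carrier M)\<^esub> d) = free_eval M c \<otimes>\<^bsub>M\<^esub> free_eval M d"
    by simp
qed

lemma free_eval_frag_of:
  assumes "comm_group M" "m \<in> carrier M"
  shows "free_eval M (frag_of m) = m"
proof -
  interpret M: comm_group M by fact
  show ?thesis
    using assms(2) by (simp add: free_eval_def)
qed

lemma hom_free_Abelian_group_eqI:
  assumes "group M" "h \<in> hom (free_Abelian_group S) M" "k \<in> hom (free_Abelian_group S) M"
    and "\<And>a. a \<in> S \<Longrightarrow> h (frag_of a) = k (frag_of a)" and "x \<in> carrier (free_Abelian_group S)"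
  shows "h x = k x"
proof -
  interpret M: group M by fact
  interpret h: group_hom "free_Abelian_group S" M h
    by (simp add: group_hom_def group_hom_axioms_def assms(1,2))
  interpret k: group_hom "free_Abelian_group S" M k
    by (simp add: group_hom_def group_hom_axioms_def assms(1,3))
  have diff: "f (x - y) = f x \<otimes>\<^bsub>M\<^esub> inv\<^bsub>M\<^esub> f y"
    if "group_hom (free_Abelian_group S) M f" "Poly_Mapping.keys x \<subseteq> S" "Poly_Mapping.keys y \<subseteq> S" for f x y
  proof -
    interpret f: group_hom "free_Abelian_group S" M f by fact
    show ?thesis
      using that(2,3) f.hom_mult[of x "- y"] f.hom_inv[of y] by simp
  qed
  show ?thesis
  proof (rule free_Abelian_group_induct[of x S "\<lambda>x. h x = k x"])
    show "Poly_Mapping.keys x \<subseteq> S"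
      using assms(5) by simp
    show "h 0 = k 0"
      using h.hom_one k.hom_one by simp
    show "h (x - y) = k (x - y)"
      if "Poly_Mapping.keys x \<subseteq> S" "Poly_Mapping.keys y \<subseteq> S" "h x = k x" "h y = k y" for x y
      using that by (simp add: diff h.group_hom_axioms k.group_hom_axioms)
  qed (rule assms(4))
qed

text \<open>Comparison of the presentation \<open>K \<rightarrow> P \<rightarrow> P/K\<close> with the canonical one \<open>R \<rightarrow> F \<rightarrow> P/K\<close>. Let \<open>t : P \<rightarrow> F\<close> be
the given lift of the identity of \<open>P/K\<close> and \<open>u : F \<rightarrow> P\<close> a lift in the other direction, which exists because \<open>F\<close> is free. Then
\<open>x - t (u x)\<close> lies in \<open>R\<close> and \<open>u (t x) - x\<close> lies in \<open>K\<close>: these are the homotopies that make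
pullback along \<open>t\<close> and pullback along \<open>u\<close> mutually inverse on the cokernels. If \<open>\<psi> \<circ> t\<close> extends to \<open>\<chi>\<close> on
\<open>P\<close>, then \<open>x \<mapsto> \<chi> (u x) + \<psi> (x - t (u x))\<close> extends \<open>\<psi>\<close> to \<open>F\<close>. Conversely, for \<open>\<phi>\<close> on \<open>K\<close> the map
\<open>x \<mapsto> \<phi> (u (t x) - x)\<close> is defined on all of \<open>P\<close>, so \<open>\<phi>\<close> and \<open>\<phi> \<circ> u \<circ> t\<close> have the same class.\<close>

theorem Ext1_ident_iso:
  fixes P :: "('p, 'm) monoid_scheme" and A :: "('a, 'k) monoid_scheme"
  assumes P: "comm_group P" and K: "subgroup K P" and A: "comm_group A"
    and lift: "\<exists>t. t \<in> hom P (free_Abelian_group (carrier (P Mod K))) \<and>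
       (\<forall>x\<in>carrier P. free_eval (P Mod K) (t x) = K #>\<^bsub>P\<^esub> x)"
  shows "Ext1_ident P K A \<in> iso (Ext1 (P Mod K) A) (res_coker P K A)"
proof -
  interpret P: comm_group P by fact
  interpret A: comm_group A by fact
  have normal: "K \<lhd> P"
    using K by (simp add: P.normal_iff_subgroup)
  interpret K: normal K P by fact
  define M where "M = P Mod K"
  interpret M: comm_group M
    unfolding M_def by (rule P.abelian_FactGroup) (rule K)
  have one_M: "\<one>\<^bsub>M\<^esub> = K"
    by (simp add: M_def)
  define F where "F = free_Abelian_group (carrier M)"
  interpret F: comm_group F
    unfolding F_def by (rule abelian_free_Abelian_group)
  interpret e: group_hom F M "free_eval M"
    by unfold_locales (simp add: F_def free_eval_hom M.comm_group_axioms)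
  define R where "R = kernel F M (free_eval M)"
  have R: "subgroup R F"
    unfolding R_def by (rule e.subgroup_kernel)
  have R_iff: "x \<in> R \<longleftrightarrow> x \<in> carrier F \<and> free_eval M x = \<one>\<^bsub>M\<^esub>" for x
    by (simp add: R_def kernel_def)
  interpret R: subgroup R F by fact
  define t where "t = resolution_lift P K"
  have "t \<in> hom P F \<and> (\<forall>x\<in>carrier P. free_eval M (t x) = K #>\<^bsub>P\<^esub> x)"
    unfolding t_def resolution_lift_def F_def M_def by (rule someI_ex[OF lift])
  then have t: "t \<in> hom P F" and e_t: "\<And>x. x \<in> carrier P \<Longrightarrow> free_eval M (t x) = K #>\<^bsub>P\<^esub> x"
    by auto
  interpret t: group_hom P F t
    by unfold_locales (rule t)
  have t_K: "t x \<in> R" if "x \<in> K" for x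
  proof -
    have x: "x \<in> carrier P"
      using that K.subset by blast
    have "free_eval M (t x) = \<one>\<^bsub>M\<^esub>"
      using e_t[OF x] K.rcos_const[OF P.is_group that] one_M by metis
    then show ?thesis
      using R_iff t.hom_closed[OF x] by blast
  qed

  obtain u where u: "u \<in> hom F P" and u_gen: "\<And>m. m \<in> carrier M \<Longrightarrow> u (frag_of m) = (SOME x. x \<in> m)"
  proof (rule P.free_Abelian_group_universal[of "\<lambda>m. SOME x. x \<in> m" "carrier M"])
    have "(SOME x. x \<in> m) \<in> carrier P" if m: "m \<in> carrier M" for m
    proof -
      obtain y where "y \<in> carrier P" "m = K #>\<^bsub>P\<^esub> y"
        using m by (auto simp: M_def carrier_FactGroup)
      then have "y \<in> m" "m \<subseteq> carrier P"
        using P.rcos_self[OF _ K] P.r_coset_subset_G[OF K.subset] by auto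
      then show ?thesis
        using someI[of "\<lambda>x. x \<in> m" y] by blast
    qed
    then show "(\<lambda>m. SOME x. x \<in> m) ` carrier M \<subseteq> carrier P"
      by blast
  qed (simp add: F_def)
  interpret u: group_hom F P u
    by unfold_locales (rule u)
  have coset_hom: "(\<lambda>x. K #>\<^bsub>P\<^esub> x) \<in> hom P M"
    unfolding M_def by (rule K.r_coset_hom_Mod)
  have coset_u: "K #>\<^bsub>P\<^esub> u c = free_eval M c" if "c \<in> carrier F" for c
  proof (rule hom_free_Abelian_group_eqI[OF M.is_group, of "\<lambda>c. K #>\<^bsub>P\<^esub> u c" "carrier M"])
    show "(\<lambda>c. K #>\<^bsub>P\<^esub> u c) \<in> hom (free_Abelian_group (carrier M)) M"
      using hom_compose[OF u coset_hom] by (simp add: o_def F_def)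
    show "free_eval M \<in> hom (free_Abelian_group (carrier M)) M"
      by (rule free_eval_hom) unfold_locales
    show "c \<in> carrier (free_Abelian_group (carrier M))"
      using that by (simp add: F_def)
    fix m assume m: "m \<in> carrier M"
    then obtain y where y: "y \<in> carrier P" "m = K #>\<^bsub>P\<^esub> y"
      by (auto simp: M_def carrier_FactGroup)
    then have "(SOME x. x \<in> m) \<in> m"
      using P.rcos_self[OF _ K] someI[of "\<lambda>x. x \<in> m" y] by blast
    then have "m = K #>\<^bsub>P\<^esub> (SOME x. x \<in> m)"
      using P.repr_independence[OF _ y(1) K] y(2) by blast
    then show "K #>\<^bsub>P\<^esub> u (frag_of m) = free_eval M (frag_of m)"
      using m by (simp add: u_gen free_eval_frag_of M.comm_group_axioms)
  qed
  have u_R: "u x \<in> K" if "x \<in> R" for x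
  proof -
    have "x \<in> carrier F" "free_eval M x = \<one>\<^bsub>M\<^esub>"
      using that R_iff by blast+
    then have "K #>\<^bsub>P\<^esub> u x = K" "u x \<in> carrier P"
      using coset_u[of x] one_M u.hom_closed[of x] by simp_all
    then show ?thesis
      using P.coset_join1 K by blast
  qed
  \<comment> \<open>the two homotopies: both lifts induce the identity on \<open>P/K\<close>\<close>
  have defect_R: "x \<otimes>\<^bsub>F\<^esub> inv\<^bsub>F\<^esub> t (u x) \<in> R" if "x \<in> carrier F" for x
  proof -
    have "free_eval M (t (u x)) = free_eval M x"
      using that e_t[of "u x"] coset_u[OF that] by simp
    moreover have "t (u x) \<in> carrier F"
      using that by simp
    ultimately have "free_eval M (x \<otimes>\<^bsub>F\<^esub> inv\<^bsub>F\<^esub> t (u x)) = \<one>\<^bsub>M\<^esub>"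
      using that e.hom_mult e.hom_inv e.hom_closed M.r_inv F.inv_closed by metis
    then show ?thesis
      using R_iff F.m_closed[OF that F.inv_closed[OF \<open>t (u x) \<in> carrier F\<close>]] by blast
  qed
  have defect_K: "u (t x) \<otimes>\<^bsub>P\<^esub> inv\<^bsub>P\<^esub> x \<in> K" if "x \<in> carrier P" for x
  proof -
    have "K #>\<^bsub>P\<^esub> u (t x) = K #>\<^bsub>P\<^esub> x"
      using that coset_u[of "t x"] e_t by simp
    then have "u (t x) \<in> K #>\<^bsub>P\<^esub> x"
      using that P.rcos_self[OF _ K, of "u (t x)"] by simp
    then show ?thesis
      using that K.rcos_module_imp[OF P.is_group] by blast
  qed

  define \<Gamma> where "\<Gamma> = hom_group (F\<lparr>carrier := R\<rparr>) A"
  define \<Delta> where "\<Delta> = hom_group (P\<lparr>carrier := K\<rparr>) A"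
  have FR: "group (F\<lparr>carrier := R\<rparr>)" and PK: "group (P\<lparr>carrier := K\<rparr>)"
    by (rule R.subgroup_is_group K.subgroup_is_group, rule F.is_group P.is_group)+
  interpret \<Gamma>: comm_group \<Gamma>
    unfolding \<Gamma>_def using FR A by (rule comm_group_hom_group)
  interpret \<Delta>: comm_group \<Delta>
    unfolding \<Delta>_def using PK A by (rule comm_group_hom_group)
  define N where "N = res_image F R A"
  define N' where "N' = res_image P K A"
  have N: "subgroup N \<Gamma>" and N': "subgroup N' \<Delta>"
    unfolding N_def \<Gamma>_def N'_def \<Delta>_def
    by (rule subgroup_res_image F.is_group P.is_group R K A)+
  have nN: "N \<lhd> \<Gamma>" and nN': "N' \<lhd> \<Delta>"
    using N N' by (simp_all add: \<Gamma>.normal_iff_subgroup \<Delta>.normal_iff_subgroup)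
  interpret N: normal N \<Gamma> by fact
  interpret N': normal N' \<Delta> by fact
  have coker: "res_coker P K A = \<Delta> Mod N'" and Ext: "Ext1 (P Mod K) A = \<Gamma> Mod N"
    by (simp_all add: res_coker_def Ext1_def \<Gamma>_def \<Delta>_def N_def N'_def R_def F_def M_def)
  define T where "T = (\<lambda>\<psi> :: ('p set \<Rightarrow>\<^sub>0 int) \<Rightarrow> 'a. \<lambda>x\<in>K. \<psi> (t x))"
  have "t \<in> hom (P\<lparr>carrier := K\<rparr>) (F\<lparr>carrier := R\<rparr>)"
    using t_K K.subset t.hom_mult by (auto simp: hom_def)
  from pullback_hom[OF PK this, of A] have T: "T \<in> hom \<Gamma> \<Delta>"
    by (simp add: T_def \<Gamma>_def \<Delta>_def)
  define g where "g = (\<lambda>\<psi>. N' #>\<^bsub>\<Delta>\<^esub> T \<psi>)"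
  have g: "g \<in> hom \<Gamma> (\<Delta> Mod N')"
    using hom_compose[OF T N'.r_coset_hom_Mod] by (simp add: g_def o_def)
  have g_one_iff: "g \<psi> = \<one>\<^bsub>\<Delta> Mod N'\<^esub> \<longleftrightarrow> T \<psi> \<in> N'" if "\<psi> \<in> carrier \<Gamma>" for \<psi>
    using hom_in_carrier[OF T that] \<Delta>.coset_join1[OF _ _ N'] \<Delta>.coset_join2[OF _ N']
    by (auto simp: g_def)
  have ident: "Ext1_ident P K A = (\<lambda>X. the_elem (g ` X))"
    by (simp add: Ext1_ident_def g_def T_def N'_def \<Delta>_def t_def fun_eq_iff)

  have g_N: "g \<psi> = \<one>\<^bsub>\<Delta> Mod N'\<^esub>" if \<psi>: "\<psi> \<in> N" for \<psi>
  proof -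
    obtain \<chi> where \<chi>: "\<chi> \<in> carrier (hom_group F A)" "\<psi> = restrict \<chi> R"
      using \<psi> by (auto simp: N_def res_image_def)
    have "T \<psi> = restrict (\<lambda>x\<in>carrier P. \<chi> (t x)) K"
      using t_K K.subset by (auto simp: T_def \<chi>(2) fun_eq_iff)
    then have "T \<psi> \<in> N'"
      using restrict_in_res_image[OF pullback_in_hom_group[OF P.is_group t \<chi>(1)], of K]
      unfolding N'_def by (simp only:)
    then show ?thesis
      using \<psi> N.subset g_one_iff by blast
  qed
  have g_inj: "\<psi> \<in> N" if \<psi>: "\<psi> \<in> carrier \<Gamma>" and "g \<psi> = \<one>\<^bsub>\<Delta> Mod N'\<^esub>" for \<psi>
  proof -
    have "T \<psi> \<in> N'"
      using that g_one_iff by blast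
    then obtain \<chi> where \<chi>: "\<chi> \<in> carrier (hom_group P A)" "T \<psi> = restrict \<chi> K"
      by (auto simp: N'_def res_image_def)
    have \<psi>_hom: "\<psi> \<in> hom (F\<lparr>carrier := R\<rparr>) A" and \<chi>_hom: "\<chi> \<in> hom P A"
      using \<psi> \<chi> by (simp_all add: \<Gamma>_def carrier_hom_group)
    define \<psi>' where "\<psi>' x = \<chi> (u x) \<otimes>\<^bsub>A\<^esub> \<psi> (x \<otimes>\<^bsub>F\<^esub> inv\<^bsub>F\<^esub> t (u x))" for x
    have "\<psi>' \<in> hom F A"
    proof (rule homI)
      have \<psi>_closed: "\<psi> x \<in> carrier A" if "x \<in> R" for x
        using hom_in_carrier[OF \<psi>_hom] that by simp
      have \<chi>_closed: "\<chi> x \<in> carrier A" if "x \<in> carrier P" for x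
        using hom_in_carrier[OF \<chi>_hom] that by simp
      show "\<psi>' x \<in> carrier A" if "x \<in> carrier F" for x
        using that by (simp add: \<psi>'_def \<psi>_closed \<chi>_closed defect_R)
      fix x y assume xy: "x \<in> carrier F" "y \<in> carrier F"
      let ?d = "\<lambda>x. x \<otimes>\<^bsub>F\<^esub> inv\<^bsub>F\<^esub> t (u x)"
      have "?d (x \<otimes>\<^bsub>F\<^esub> y) = ?d x \<otimes>\<^bsub>F\<^esub> ?d y"
        using xy by (simp add: F.inv_mult F.m_ac)
      then have "\<psi> (?d (x \<otimes>\<^bsub>F\<^esub> y)) = \<psi> (?d x) \<otimes>\<^bsub>A\<^esub> \<psi> (?d y)"
        using hom_mult[OF \<psi>_hom, of "?d x" "?d y"] defect_R xy by simp
      moreover have "\<chi> (u (x \<otimes>\<^bsub>F\<^esub> y)) = \<chi> (u x) \<otimes>\<^bsub>A\<^esub> \<chi> (u y)"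
        using hom_mult[OF \<chi>_hom] xy by simp
      ultimately show "\<psi>' (x \<otimes>\<^bsub>F\<^esub> y) = \<psi>' x \<otimes>\<^bsub>A\<^esub> \<psi>' y"
        using xy by (simp add: \<psi>'_def \<psi>_closed \<chi>_closed defect_R A.m_ac)
    qed
    then have "restrict \<psi>' (carrier F) \<in> carrier (hom_group F A)"
      by (rule restrict_in_hom_group[OF F.is_group])
    moreover have "\<psi> = restrict (restrict \<psi>' (carrier F)) R"
    proof (rule extensionalityI[of _ R])
      show "\<psi> \<in> extensional R"
        using \<psi> by (simp add: \<Gamma>_def carrier_hom_group)
      fix x assume x: "x \<in> R"
      then have xF: "x \<in> carrier F"
        using R.subset by blast
      have "\<chi> (u x) = \<psi> (t (u x))"
        using fun_cong[OF \<chi>(2), of "u x"] u_R[OF x] by (simp add: T_def)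
      then have "\<psi>' x = \<psi> (t (u x) \<otimes>\<^bsub>F\<^esub> (x \<otimes>\<^bsub>F\<^esub> inv\<^bsub>F\<^esub> t (u x)))"
        using hom_mult[OF \<psi>_hom, of "t (u x)"] t_K[OF u_R[OF x]] defect_R[OF xF] by (simp add: \<psi>'_def)
      also have "t (u x) \<otimes>\<^bsub>F\<^esub> (x \<otimes>\<^bsub>F\<^esub> inv\<^bsub>F\<^esub> t (u x)) = x"
        using xF by (metis F.inv_closed F.inv_solve_right F.m_closed F.m_comm t.hom_closed u.hom_closed)
      finally show "\<psi> x = restrict (restrict \<psi>' (carrier F)) R x"
        using x xF by simp
    qed (rule restrict_extensional)
    ultimately show ?thesis
      unfolding N_def using restrict_in_res_image[of "restrict \<psi>' (carrier F)" F A R] by (simp only:)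
  qed
  have g_onto: "X \<in> g ` carrier \<Gamma>" if X: "X \<in> carrier (\<Delta> Mod N')" for X
  proof -
    obtain \<phi> where \<phi>: "\<phi> \<in> carrier \<Delta>" "X = N' #>\<^bsub>\<Delta>\<^esub> \<phi>"
      using X by (auto simp: carrier_FactGroup)
    have \<phi>_hom: "\<phi> \<in> hom (P\<lparr>carrier := K\<rparr>) A"
      using \<phi> by (simp add: \<Delta>_def carrier_hom_group)
    have "u \<in> hom (F\<lparr>carrier := R\<rparr>) (P\<lparr>carrier := K\<rparr>)"
      using u_R R.subset u.hom_mult by (auto simp: hom_def)
    from pullback_in_hom_group[OF FR this, of \<phi> A] \<phi>(1)
    have \<psi>: "(\<lambda>x\<in>R. \<phi> (u x)) \<in> carrier \<Gamma>"
      by (simp add: \<Gamma>_def \<Delta>_def)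
    let ?\<psi> = "\<lambda>x\<in>R. \<phi> (u x)"
    have defect_hom: "(\<lambda>x. u (t x) \<otimes>\<^bsub>P\<^esub> inv\<^bsub>P\<^esub> x) \<in> hom P (P\<lparr>carrier := K\<rparr>)"
    proof (rule homI)
      show "u (t x) \<otimes>\<^bsub>P\<^esub> inv\<^bsub>P\<^esub> x \<in> carrier (P\<lparr>carrier := K\<rparr>)" if "x \<in> carrier P" for x
        using defect_K[OF that] by simp
    qed (simp add: P.inv_mult P.m_ac)
    from pullback_in_hom_group[OF P.is_group this, of \<phi> A] \<phi>(1)
    have \<chi>: "(\<lambda>x\<in>carrier P. \<phi> (u (t x) \<otimes>\<^bsub>P\<^esub> inv\<^bsub>P\<^esub> x)) \<in> carrier (hom_group P A)"
      by (simp add: \<Delta>_def)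
    let ?\<chi> = "restrict (\<lambda>x\<in>carrier P. \<phi> (u (t x) \<otimes>\<^bsub>P\<^esub> inv\<^bsub>P\<^esub> x)) K"
    have \<chi>_N': "?\<chi> \<in> N'"
      unfolding N'_def using \<chi> by (rule restrict_in_res_image)
    have "T ?\<psi> = ?\<chi> \<otimes>\<^bsub>\<Delta>\<^esub> \<phi>"
    proof (rule hom_group_eqI[of _ "P\<lparr>carrier := K\<rparr>" A])
      show "T ?\<psi> \<in> carrier (hom_group (P\<lparr>carrier := K\<rparr>) A)"
        using hom_in_carrier[OF T \<psi>] by (simp add: \<Delta>_def)
      show "?\<chi> \<otimes>\<^bsub>\<Delta>\<^esub> \<phi> \<in> carrier (hom_group (P\<lparr>carrier := K\<rparr>) A)"
        using \<chi>_N' N'.subset \<phi>(1) \<Delta>.m_closed unfolding \<Delta>_def by blast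
      fix x assume "x \<in> carrier (P\<lparr>carrier := K\<rparr>)"
      then have x: "x \<in> K" "x \<in> carrier P"
        using K.subset by auto
      have "\<phi> (u (t x) \<otimes>\<^bsub>P\<^esub> inv\<^bsub>P\<^esub> x) \<otimes>\<^bsub>A\<^esub> \<phi> x = \<phi> (u (t x) \<otimes>\<^bsub>P\<^esub> inv\<^bsub>P\<^esub> x \<otimes>\<^bsub>P\<^esub> x)"
        using hom_mult[OF \<phi>_hom, of "u (t x) \<otimes>\<^bsub>P\<^esub> inv\<^bsub>P\<^esub> x" x] x defect_K by simp
      also have "u (t x) \<otimes>\<^bsub>P\<^esub> inv\<^bsub>P\<^esub> x \<otimes>\<^bsub>P\<^esub> x = u (t x)"
        using x by (simp add: P.m_assoc)
      finally show "T ?\<psi> x = (?\<chi> \<otimes>\<^bsub>\<Delta>\<^esub> \<phi>) x"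
        using x t_K by (simp add: T_def \<Delta>_def hom_group_def)
    qed
    then have "T ?\<psi> \<in> N' #>\<^bsub>\<Delta>\<^esub> \<phi>"
      using \<Delta>.rcosI[OF \<chi>_N' N'.subset \<phi>(1)] by (simp only:)
    from \<Delta>.repr_independence[OF this \<phi>(1) N'] have "X = g ?\<psi>"
      unfolding g_def \<phi>(2) .
    then show ?thesis
      using \<psi> by (rule image_eqI)
  qed

  have grp: "group (\<Delta> Mod N')"
    by (rule N'.factorgroup_is_group)
  have "(\<lambda>X. the_elem (g ` X)) \<in> mon (\<Gamma> Mod N) (\<Delta> Mod N')"
    by (rule FactGroup_induced_mon[OF \<Gamma>.is_group grp nN g g_N g_inj])
  moreover have "g ` carrier \<Gamma> = carrier (\<Delta> Mod N')"
    using g_onto hom_carrier[OF g] by (intro subset_antisym subsetI) (simp_all add: subset_iff)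
  with FactGroup_induced_image[OF \<Gamma>.is_group grp nN g g_N]
  have "(\<lambda>X. the_elem (g ` X)) ` carrier (\<Gamma> Mod N) = carrier (\<Delta> Mod N')"
    by (rule trans)
  ultimately show ?thesis
    unfolding ident coker Ext by (simp add: iso_def mon_def bij_betw_def)
qed

lemma comm_group_Ext1:
  assumes M: "comm_group M" and A: "comm_group A"
  shows "comm_group (Ext1 M A)"
proof -
  have "group_hom (free_Abelian_group (carrier M)) M (free_eval M)"
    by (simp add: group_hom_def group_hom_axioms_def free_eval_hom M comm_group.axioms(2))
  then show ?thesis
    unfolding Ext1_def by (intro comm_group_res_coker group_hom.subgroup_kernel A) simp_all
qed

section \<open>Faces and the differential of the bar complex\<close>

text \<open>The three shapes of summands in the bar differential (drop the first entry, merge two neighbours, drop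
the last entry) are given by one entrywise formula. At \<open>i = 0\<close> and at \<open>i = length gs\<close> the merging case
does not occur, so the formula returns the tail and the initial segment. In this form the
simplicial identities become a comparison of entries.\<close>

definition bar_face :: "('g, 'm) monoid_scheme \<Rightarrow> nat \<Rightarrow> 'g list \<Rightarrow> 'g list"
  where "bar_face G i gs = map (\<lambda>k. if k + 1 < i then gs ! k
      else if k + 1 = i then gs ! k \<otimes>\<^bsub>G\<^esub> gs ! (k + 1) else gs ! (k + 1)) [0..<length gs - 1]"

lemma length_bar_face [simp]: "length (bar_face G i gs) = length gs - 1"
  by (simp add: bar_face_def)

lemma bar_face_nth:
  "k < length gs - 1 \<Longrightarrow> bar_face G i gs ! k = (if k + 1 < i then gs ! k
      else if k + 1 = i then gs ! k \<otimes>\<^bsub>G\<^esub> gs ! (k + 1) else gs ! (k + 1))"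
  by (simp add: bar_face_def)

lemma bar_boundary_gen_eq_faces:
  assumes "length gs = Suc n"
  shows "bar_boundary_gen G gs = (\<Sum>i\<le>Suc n. frag_cmul ((-1) ^ i) (bar G (bar_face G i gs)))"
proof -
  have first: "bar_face G 0 gs = tl gs"
    by (rule nth_equalityI) (auto simp: bar_face_nth nth_tl)
  have last: "bar_face G (Suc n) gs = butlast gs"
    by (rule nth_equalityI) (use assms in \<open>auto simp: bar_face_nth nth_butlast\<close>)
  have mid: "bar_face G i gs = merge_at G i gs" if "i \<in> {1..<Suc n}" for i
  proof (rule nth_equalityI)
    fix k assume "k < length (bar_face G i gs)"
    then have k: "k < n"
      by (simp add: assms)
    obtain l where l: "i = Suc l" "l < n"
      using \<open>i \<in> {1..<Suc n}\<close> by (cases i) auto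
    consider "k < l" | "k = l" | d where "k = Suc (l + d)"
      using less_imp_Suc_add nat_neq_iff by blast
    then show "bar_face G i gs ! k = merge_at G i gs ! k"
      by cases (use k l in \<open>simp_all add: bar_face_nth merge_at_def assms nth_append\<close>)
  qed (use that assms in \<open>auto simp: merge_at_def\<close>)
  have "{..Suc n} = insert 0 (insert (Suc n) {1..<Suc n})"
    by auto
  then have "(\<Sum>i\<le>Suc n. frag_cmul ((-1) ^ i) (bar G (bar_face G i gs)))
    = bar G (tl gs) + (frag_cmul ((-1) ^ Suc n) (bar G (butlast gs))
       + (\<Sum>i\<in>{1..<Suc n}. frag_cmul ((-1) ^ i) (bar G (merge_at G i gs))))"
    by (simp add: first last mid del: power_Suc)
  then show ?thesis
    by (simp add: bar_boundary_gen_def assms add_ac)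
qed

lemma set_bar_face:
  assumes "group G" "set gs \<subseteq> carrier G"
  shows "set (bar_face G i gs) \<subseteq> carrier G"
proof -
  interpret group G by fact
  have "gs ! k \<in> carrier G" if "k < length gs" for k
    using that assms(2) by auto
  then show ?thesis
    by (auto simp: bar_face_def)
qed

text \<open>The simplicial identity \<open>d\<^sub>i d\<^sub>j = d\<^sub>j\<^sub>-\<^sub>1 d\<^sub>i\<close> for \<open>i < j\<close>. Associativity enters only for two inner faces with
\<open>j = i + 1\<close>, where both sides merge the same three neighbours.\<close>

lemma bar_face_bar_face:
  assumes "group G" "set gs \<subseteq> carrier G" "i < j" "j \<le> length gs"
  shows "bar_face G i (bar_face G j gs) = bar_face G (j - 1) (bar_face G i gs)"
proof -
  interpret group G by fact
  have [simp]: "gs ! k \<in> carrier G" if "k < length gs" for k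
    using that assms(2) by auto
  show ?thesis
    by (rule nth_equalityI) (use assms(3,4) in \<open>auto simp: bar_face_nth m_assoc\<close>)
qed

text \<open>The terms with \<open>i < j\<close> cancel against those with \<open>i \<ge> j\<close> under \<open>(j, i) \<mapsto> (i, j - 1)\<close>, which changes
the parity of \<open>i + j\<close>. Together with the simplicial identity this is the reason why the bar differential squares to
zero.\<close>

lemma alternating_double_sum_eq_0:
  fixes f :: "nat \<Rightarrow> nat \<Rightarrow> ('b \<Rightarrow>\<^sub>0 int)"
  assumes swap: "\<And>i j. \<lbrakk>i < j; j \<le> Suc n\<rbrakk> \<Longrightarrow> f i j = f (j - 1) i"
  shows "(\<Sum>j\<le>Suc n. frag_cmul ((-1) ^ j) (\<Sum>i\<le>n. frag_cmul ((-1) ^ i) (f i j))) = 0"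
proof -
  define g where "g = (\<lambda>(j, i). frag_cmul ((-1) ^ (i + j)) (f i j))"
  define L where "L = {(j, i). i < j \<and> j \<le> Suc n}"
  define R where "R = {(j, i). j \<le> i \<and> i \<le> n}"
  have fin: "finite L" "finite R"
    by (rule finite_subset[of _ "{..Suc n} \<times> {..Suc n}"]; force simp: L_def R_def)+
  have "(\<Sum>j\<le>Suc n. frag_cmul ((-1) ^ j) (\<Sum>i\<le>n. frag_cmul ((-1) ^ i) (f i j)))
      = (\<Sum>j\<le>Suc n. \<Sum>i\<le>n. g (j, i))"
    unfolding frag_cmul_sum
    by (intro sum.cong refl) (simp only: g_def prod.case frag_cmul_cmul power_add mult.commute)
  also have "\<dots> = sum g ({..Suc n} \<times> {..n})"
    by (simp only: sum.cartesian_product case_prod_eta)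
  also have "{..Suc n} \<times> {..n} = L \<union> R"
    by (auto simp: L_def R_def)
  also have "sum g (L \<union> R) = sum g L + sum g R"
    by (rule sum.union_disjoint[OF fin]) (auto simp: L_def R_def)
  also have "sum g L = (\<Sum>x\<in>R. - g x)"
  proof (rule sum.reindex_bij_witness[where i = "\<lambda>(j, i). (Suc i, j)" and j = "\<lambda>(j, i). (i, j - 1)"])
    fix x assume "x \<in> L"
    then obtain j i where x: "x = (Suc j, i)" "i < Suc j" "Suc j \<le> Suc n"
      by (cases x; cases "fst x") (auto simp: L_def)
    then show "- g (case x of (j, i) \<Rightarrow> (i, j - 1)) = g x"
      using swap[of i "Suc j"] by (simp add: g_def add.commute)
  qed (auto simp: L_def R_def)
  finally show ?thesis
    by (simp add: sum_negf)
qed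

text \<open>This is what makes the normalized complex well defined. If the entry at position \<open>p\<close> is the unit,
it survives in every face except the two that absorb it into a neighbour, or drop it at an end of the tuple; these are the faces \<open>p\<close>
and \<open>p + 1\<close>, they coincide, and they carry opposite signs.\<close>

lemma bar_boundary_gen_degenerate:
  assumes "group G" "set gs \<subseteq> carrier G" "\<one>\<^bsub>G\<^esub> \<in> set gs"
  shows "bar_boundary_gen G gs = 0"
proof -
  interpret group G by fact
  have gs[simp]: "gs ! k \<in> carrier G" if "k < length gs" for k
    using that assms(2) by auto
  obtain p where p: "p < length gs" "gs ! p = \<one>\<^bsub>G\<^esub>"
    using assms(3) by (auto simp: in_set_conv_nth)
  then obtain n where n: "length gs = Suc n"
    by (cases "length gs") auto
  let ?t = "\<lambda>i. frag_cmul ((-1) ^ i) (bar G (bar_face G i gs))"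
  have eq: "bar_face G p gs = bar_face G (Suc p) gs"
  proof (rule nth_equalityI)
    fix k assume "k < length (bar_face G p gs)"
    then have k: "k < n"
      by (simp add: n)
    consider "Suc k < p" | "Suc k = p" | "k = p" | "p < k"
      by linarith
    then show "bar_face G p gs ! k = bar_face G (Suc p) gs ! k"
      by cases (use k p n in \<open>auto simp: bar_face_nth\<close>)
  qed simp
  have zero: "?t i = 0" if i: "i \<le> Suc n" "i \<noteq> p" "i \<noteq> Suc p" for i
  proof -
    \<comment> \<open>position of the surviving unit: it moves to the left if the face acts before it\<close>
    let ?k = "if i < p then p - 1 else p"
    have "?k < length (bar_face G i gs)" "bar_face G i gs ! ?k = \<one>\<^bsub>G\<^esub>"
      using i p n by (auto simp: bar_face_nth)
    then have "\<one>\<^bsub>G\<^esub> \<in> set (bar_face G i gs)"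
      by (metis nth_mem)
    then show ?thesis
      by (simp add: bar_def)
  qed
  have "bar_boundary_gen G gs = sum ?t {..Suc n}"
    by (rule bar_boundary_gen_eq_faces[OF n])
  also have "\<dots> = sum ?t {p, Suc p}"
    by (rule sum.mono_neutral_right) (use p n zero in auto)
  also have "\<dots> = 0"
    by (simp add: eq frag_cmul_diff_distrib flip: frag_cmul_distrib)
  finally show ?thesis .
qed

lemma frag_extend_bar_boundary_gen:
  assumes "group G" "set gs \<subseteq> carrier G"
  shows "frag_extend (bar_boundary_gen G) (bar G gs) = bar_boundary_gen G gs"
  using bar_boundary_gen_degenerate[OF assms] by (simp add: bar_def)

lemma bar_in_chains:
  assumes "set gs \<subseteq> carrier G" "length gs = n"
  shows "bar G gs \<in> carrier (bar_chains G n)"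
  using assms by (auto simp: bar_def bar_chains_def)

lemma bar_boundary_gen_in_chains:
  assumes "group G" "set gs \<subseteq> carrier G" "length gs = Suc n"
  shows "bar_boundary_gen G gs \<in> carrier (bar_chains G n)"
  unfolding bar_boundary_gen_eq_faces[OF assms(3)] bar_chains_def
proof (rule sum_closed_free_Abelian_group)
  fix i
  show "frag_cmul ((-1) ^ i) (bar G (bar_face G i gs))
      \<in> carrier (free_Abelian_group {gs. length gs = n \<and> set gs \<subseteq> carrier G - {\<one>\<^bsub>G\<^esub>}})"
    using bar_in_chains[OF set_bar_face[OF assms(1,2)], of i n] assms(3)
    by (auto simp: bar_chains_def)
qed

lemma bar_boundary_gen_boundary:
  assumes "group G" "set gs \<subseteq> carrier G" "length gs = Suc (Suc n)"
  shows "frag_extend (bar_boundary_gen G) (bar_boundary_gen G gs) = 0"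
proof -
  have "frag_extend (bar_boundary_gen G) (bar_boundary_gen G gs)
    = (\<Sum>j\<le>Suc (Suc n). frag_cmul ((-1) ^ j) (bar_boundary_gen G (bar_face G j gs)))"
    by (simp add: bar_boundary_gen_eq_faces[OF assms(3)] frag_extend_sum o_def frag_extend_cmul
        frag_extend_bar_boundary_gen[OF assms(1) set_bar_face[OF assms(1,2)]] frag_extend_add
        del: sum.atMost_Suc)
  also have "\<dots> = (\<Sum>j\<le>Suc (Suc n). frag_cmul ((-1) ^ j)
      (\<Sum>i\<le>Suc n. frag_cmul ((-1) ^ i) (bar G (bar_face G i (bar_face G j gs)))))"
    using assms(3) by (simp add: bar_boundary_gen_eq_faces[where n = n] del: sum.atMost_Suc)
  also have "\<dots> = 0"
    by (rule alternating_double_sum_eq_0) (use bar_face_bar_face[OF assms(1,2)] assms(3) in simp)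
  finally show ?thesis .
qed

lemma bar_boundary_add: "bar_boundary G n (x + y) = bar_boundary G n x + bar_boundary G n y"
  by (simp add: bar_boundary_def frag_extend_add)

lemma bar_boundary_hom:
  assumes "group G"
  shows "bar_boundary G n \<in> hom (bar_chains G n) (bar_chains G (n - 1))"
proof (rule homI)
  fix x y
  show "bar_boundary G n (x \<otimes>\<^bsub>bar_chains G n\<^esub> y) =
    bar_boundary G n x \<otimes>\<^bsub>bar_chains G (n - 1)\<^esub> bar_boundary G n y"
    by (simp add: bar_chains_def bar_boundary_add)
  assume x: "x \<in> carrier (bar_chains G n)"
  show "bar_boundary G n x \<in> carrier (bar_chains G (n - 1))"
  proof (cases n)
    case 0
    then show ?thesis
      by (simp add: bar_boundary_def bar_chains_def)
  next
    case (Suc m)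
    have "Poly_Mapping.keys (bar_boundary_gen G gs) \<subseteq> {gs. length gs = m \<and> set gs \<subseteq> carrier G - {\<one>\<^bsub>G\<^esub>}}"
      if "gs \<in> Poly_Mapping.keys x" for gs
    proof -
      have "length gs = Suc m" "set gs \<subseteq> carrier G"
        using that x by (auto simp: bar_chains_def Suc)
      then show ?thesis
        using bar_boundary_gen_in_chains[OF assms, of gs m] by (simp add: bar_chains_def)
    qed
    then show ?thesis
      using keys_frag_extend[of "bar_boundary_gen G" x]
      by (fastforce simp: Suc bar_boundary_def bar_chains_def)
  qed
qed

lemma bar_boundary_boundary:
  assumes "group G" "c \<in> carrier (bar_chains G (n + 1))"
  shows "bar_boundary G n (bar_boundary G (n + 1) c) = 0"
proof (cases n)
  case 0
  then show ?thesis
    by (simp add: bar_boundary_def)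
next
  case (Suc m)
  have "Poly_Mapping.keys c \<subseteq> {gs. length gs = Suc (Suc m) \<and> set gs \<subseteq> carrier G - {\<one>\<^bsub>G\<^esub>}}"
    using assms(2) by (simp add: bar_chains_def Suc)
  then have "frag_extend (bar_boundary_gen G) (frag_extend (bar_boundary_gen G) c) = 0"
    by (induction c rule: frag_induction)
      (auto simp: frag_extend_diff intro!: bar_boundary_gen_boundary[OF assms(1)])
  then show ?thesis
    by (simp add: bar_boundary_def Suc)
qed

section \<open>Antisymmetrized commuting tuples are cycles\<close>

definition cyclic_shift :: "nat \<Rightarrow> nat \<Rightarrow> nat"
  where "cyclic_shift n k = (if k < n then Suc k else if k = n then 0 else k)"

lemma cyclic_shift_permutes_sign: "cyclic_shift n permutes {..<Suc n} \<and> sign (cyclic_shift n) = (-1) ^ n"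
proof (induction n)
  case 0
  have "cyclic_shift 0 = id"
    by (auto simp: cyclic_shift_def fun_eq_iff)
  then show ?case
    by (simp only: permutes_id sign_id power_0 simp_thms)
next
  case (Suc n)
  have eq: "cyclic_shift (Suc n) = transpose 0 (Suc n) \<circ> cyclic_shift n"
    by (auto simp: cyclic_shift_def fun_eq_iff transpose_def)
  have t: "transpose 0 (Suc n) permutes {..<Suc (Suc n)}"
    by (rule permutes_swap_id) auto
  have c: "cyclic_shift n permutes {..<Suc (Suc n)}"
    by (rule permutes_subset[of _ "{..<Suc n}"]) (use Suc in auto)
  have "sign (cyclic_shift (Suc n)) = sign (transpose 0 (Suc n)) * sign (cyclic_shift n)"
    unfolding eq by (rule sign_compose) (use t c permutation_permutes in blast)+
  then show ?case
    using Suc permutes_compose[OF c t] by (simp add: eq sign_swap_id del: o_apply)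
qed

definition antisymmetrized_bar :: "('g, 'm) monoid_scheme \<Rightarrow> 'g list \<Rightarrow> ('g list \<Rightarrow>\<^sub>0 int)"
  where "antisymmetrized_bar G gs =
    (\<Sum>\<sigma> | \<sigma> permutes {..<length gs}. frag_cmul (sign \<sigma>) (bar G (permute_list \<sigma> gs)))"

lemma antisymmetrized_bar_in_chains:
  assumes "set gs \<subseteq> carrier G" "length gs = n"
  shows "antisymmetrized_bar G gs \<in> carrier (bar_chains G n)"
  unfolding antisymmetrized_bar_def bar_chains_def
proof (rule sum_closed_free_Abelian_group)
  fix \<sigma> assume "\<sigma> \<in> {\<sigma>. \<sigma> permutes {..<length gs}}"
  then have "bar G (permute_list \<sigma> gs) \<in> carrier (bar_chains G n)"
    using assms by (intro bar_in_chains) auto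
  then show "frag_cmul (sign \<sigma>) (bar G (permute_list \<sigma> gs))
      \<in> carrier (free_Abelian_group {gs. length gs = n \<and> set gs \<subseteq> carrier G - {\<one>\<^bsub>G\<^esub>}})"
    by (auto simp: bar_chains_def)
qed

text \<open>The sum changes sign when every \<open>\<sigma>\<close> is composed with the transposition of the two positions that the
face merges, because the merged entries commute. Hence twice the sum is zero, and the chain
groups have no torsion.\<close>

lemma antisymmetrized_inner_face:
  assumes gs: "gs \<in> commuting_tuples G (Suc n)" and i: "0 < i" "i < Suc n"
  shows "(\<Sum>\<sigma> | \<sigma> permutes {..<Suc n}. frag_cmul (sign \<sigma>) (bar G (bar_face G i (permute_list \<sigma> gs)))) = 0"
    (is "sum ?t _ = 0")
proof -
  have len: "length gs = Suc n" and comm: "\<And>k l. k < Suc n \<Longrightarrow> l < Suc n \<Longrightarrow> gs ! k \<otimes>\<^bsub>G\<^esub> gs ! l = gs ! l \<otimes>\<^bsub>G\<^esub> gs ! k"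
    using gs by (auto simp: commuting_tuples_def)
  let ?\<tau> = "transpose (i - 1) i"
  have \<tau>: "?\<tau> permutes {..<Suc n}"
    by (rule permutes_swap_id) (use i in auto)
  have "?t (\<sigma> \<circ> ?\<tau>) = - ?t \<sigma>" if \<sigma>: "\<sigma> permutes {..<Suc n}" for \<sigma>
  proof -
    have in_range: "\<sigma> k < Suc n" if "k < Suc n" for k
      using permutes_in_image[OF \<sigma>, of k] that by simp
    have "permutation \<sigma>" "permutation ?\<tau>"
      using \<sigma> \<tau> permutation_permutes by blast+
    then have "sign (\<sigma> \<circ> ?\<tau>) = - sign \<sigma>"
      using i by (simp add: sign_compose sign_swap_id)
    moreover have "bar_face G i (permute_list (\<sigma> \<circ> ?\<tau>) gs) = bar_face G i (permute_list \<sigma> gs)"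
    proof (rule nth_equalityI)
      fix k assume "k < length (bar_face G i (permute_list (\<sigma> \<circ> ?\<tau>) gs))"
      then have k: "k < n"
        by (simp add: len)
      have nth: "permute_list \<rho> gs ! l = gs ! \<rho> l" if "l < Suc n" for \<rho> l
        using that len by (simp add: permute_list_def del: upt_Suc)
      show "bar_face G i (permute_list (\<sigma> \<circ> ?\<tau>) gs) ! k = bar_face G i (permute_list \<sigma> gs) ! k"
        using k i comm in_range by (auto simp: bar_face_nth len nth transpose_def)
    qed simp
    ultimately show ?thesis
      by simp
  qed
  then have "sum ?t {\<sigma>. \<sigma> permutes {..<Suc n}} = - sum ?t {\<sigma>. \<sigma> permutes {..<Suc n}}"
    unfolding sum_negf[symmetric] by (subst sum_permutations_compose_right[OF \<tau>]) auto
  then have "frag_cmul 2 (sum ?t {\<sigma>. \<sigma> permutes {..<Suc n}}) = 0"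
    using frag_cmul_distrib[of 1 1 "sum ?t {\<sigma>. \<sigma> permutes {..<Suc n}}"] by (simp add: eq_neg_iff_add_eq_0)
  then show ?thesis
    unfolding frag_cmul_eq_0_iff by simp
qed

text \<open>Dropping the last entry after a cyclic shift of the positions is the same as dropping the first
entry.\<close>

lemma antisymmetrized_outer_faces:
  assumes len: "length gs = Suc n"
  shows "(\<Sum>\<sigma> | \<sigma> permutes {..<Suc n}. frag_cmul (sign \<sigma>) (bar G (bar_face G 0 (permute_list \<sigma> gs))))
    = frag_cmul ((-1) ^ n)
       (\<Sum>\<sigma> | \<sigma> permutes {..<Suc n}. frag_cmul (sign \<sigma>) (bar G (bar_face G (Suc n) (permute_list \<sigma> gs))))"
    (is "sum ?t _ = frag_cmul _ (sum ?u _)")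
proof -
  have c: "cyclic_shift n permutes {..<Suc n}" and sc: "sign (cyclic_shift n) = (-1) ^ n"
    using cyclic_shift_permutes_sign by blast+
  have "?u (\<sigma> \<circ> cyclic_shift n) = frag_cmul ((-1) ^ n) (?t \<sigma>)" if \<sigma>: "\<sigma> permutes {..<Suc n}" for \<sigma>
  proof -
    have "permutation \<sigma>" "permutation (cyclic_shift n)"
      using \<sigma> c permutation_permutes by blast+
    then have "sign (\<sigma> \<circ> cyclic_shift n) = (-1) ^ n * sign \<sigma>"
      by (simp add: sign_compose sc)
    moreover have "bar_face G (Suc n) (permute_list (\<sigma> \<circ> cyclic_shift n) gs) = bar_face G 0 (permute_list \<sigma> gs)"
      by (rule nth_equalityI) (auto simp: bar_face_nth permute_list_def len cyclic_shift_def simp del: upt_Suc)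
    ultimately show ?thesis
      by simp
  qed
  then have "sum ?u {\<sigma>. \<sigma> permutes {..<Suc n}} = frag_cmul ((-1) ^ n) (sum ?t {\<sigma>. \<sigma> permutes {..<Suc n}})"
    unfolding frag_cmul_sum by (subst sum_permutations_compose_right[OF c]) auto
  then show ?thesis
    by (simp flip: power_add)
qed

text \<open>Only the first and the last face survive. The first sum is \<open>(-1)\<^sup>n\<close> times the last
one by the cyclic shift, and the last face has the coefficient \<open>(-1)\<^sup>n\<^sup>+\<^sup>1\<close> in the differential, so the two
cancel.\<close>

lemma bar_boundary_antisymmetrized:
  assumes "group G" and gs: "gs \<in> commuting_tuples G (Suc n)"
  shows "bar_boundary G (Suc n) (antisymmetrized_bar G gs) = 0"
proof -
  have len: "length gs = Suc n" and sub: "set gs \<subseteq> carrier G"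
    using gs by (auto simp: commuting_tuples_def)
  let ?P = "{\<sigma>. \<sigma> permutes {..<Suc n}}"
  let ?F = "\<lambda>i. \<Sum>\<sigma>\<in>?P. frag_cmul (sign \<sigma>) (bar G (bar_face G i (permute_list \<sigma> gs)))"
  have fin: "finite ?P"
    by (simp add: finite_permutations)
  have "bar_boundary G (Suc n) (antisymmetrized_bar G gs)
      = (\<Sum>\<sigma>\<in>?P. frag_cmul (sign \<sigma>) (bar_boundary_gen G (permute_list \<sigma> gs)))"
    unfolding bar_boundary_def antisymmetrized_bar_def len
    by (simp add: frag_extend_sum[OF fin] frag_extend_cmul)
      (rule sum.cong, use sub len in \<open>auto simp: frag_extend_bar_boundary_gen[OF assms(1)]\<close>)
  also have "\<dots> = (\<Sum>\<sigma>\<in>?P. \<Sum>i\<le>Suc n. frag_cmul ((-1) ^ i) (frag_cmul (sign \<sigma>) (bar G (bar_face G i (permute_list \<sigma> gs)))))"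
    by (simp add: bar_boundary_gen_eq_faces[where n = n] len frag_cmul_sum mult.commute del: sum.atMost_Suc)
  also have "\<dots> = (\<Sum>i\<le>Suc n. frag_cmul ((-1) ^ i) (?F i))"
    by (subst sum.swap) (simp add: frag_cmul_sum del: sum.atMost_Suc)
  also have "\<dots> = (\<Sum>i\<in>{0, Suc n}. frag_cmul ((-1) ^ i) (?F i))"
    by (rule sum.mono_neutral_right) (auto simp: antisymmetrized_inner_face[OF gs])
  also have "\<dots> = ?F 0 + frag_cmul ((-1) ^ Suc n) (?F (Suc n))"
    by (simp del: power_Suc)
  also have "\<dots> = 0"
    unfolding antisymmetrized_outer_faces[OF len] by (simp flip: frag_cmul_distrib)
  finally show ?thesis .
qed

section \<open>Splitting of the bar complex into cycles and boundaries\<close>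

lemma bar_chains_mult [simp]: "x \<otimes>\<^bsub>bar_chains G n\<^esub> y = x + y"
  by (simp add: bar_chains_def)

lemma bar_chains_one [simp]: "\<one>\<^bsub>bar_chains G n\<^esub> = 0"
  by (simp add: bar_chains_def)

lemma comm_group_bar_chains: "comm_group (bar_chains G n)"
  by (simp add: bar_chains_def abelian_free_Abelian_group)

lemma bar_chains_diff:
  "\<lbrakk>x \<in> carrier (bar_chains G n); y \<in> carrier (bar_chains G n)\<rbrakk> \<Longrightarrow> x - y \<in> carrier (bar_chains G n)"
  using keys_diff[of x y] unfolding bar_chains_def carrier_free_Abelian_group_iff by blast

text \<open>The group and the coefficients are fixed once; the degree \<open>n\<close> stays variable, because the argument
compares the degrees \<open>n - 1\<close>, \<open>n\<close> and \<open>n + 1\<close>.\<close>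

locale bar_cochains = G: group G + A: comm_group A
  for G :: "('g, 'm) monoid_scheme" and A :: "('a, 'k) monoid_scheme"
begin

interpretation C: comm_group "bar_chains G n" for n
  by (rule comm_group_bar_chains)

interpretation bd: group_hom "bar_chains G n" "bar_chains G (n - 1)" "bar_boundary G n" for n
  by unfold_locales (rule bar_boundary_hom[OF G.is_group])

lemma bar_boundary_zero [simp]: "bar_boundary G n 0 = 0"
  using bd.hom_one by simp

lemma bar_boundary_diff: "bar_boundary G n (x - y) = bar_boundary G n x - bar_boundary G n y"
  by (simp add: bar_boundary_def frag_extend_diff)

lemma bar_cycles_iff:
  "c \<in> bar_cycles G n \<longleftrightarrow> c \<in> carrier (bar_chains G n) \<and> bar_boundary G n c = 0"
  by (simp add: bar_cycles_def kernel_def)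

lemma subgroup_bar_cycles: "subgroup (bar_cycles G n) (bar_chains G n)"
  unfolding bar_cycles_def by (rule bd.subgroup_kernel)

lemma subgroup_bar_boundaries: "subgroup (bar_boundaries G n) (bar_chains G n)"
  using bd.img_is_subgroup[of "n + 1"] by (simp add: bar_boundaries_def)

lemma bar_boundaries_subset_cycles: "bar_boundaries G n \<subseteq> bar_cycles G n"
proof
  fix b assume b: "b \<in> bar_boundaries G n"
  then obtain c where "c \<in> carrier (bar_chains G (n + 1))" "b = bar_boundary G (n + 1) c"
    by (auto simp: bar_boundaries_def)
  then have "bar_boundary G n b = 0"
    using bar_boundary_boundary[OF G.is_group] by simp
  moreover have "b \<in> carrier (bar_chains G n)"
    using b subgroup.subset[OF subgroup_bar_boundaries] by blast
  ultimately show "b \<in> bar_cycles G n"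
    by (simp add: bar_cycles_iff)
qed

lemma comm_group_cycle_group: "comm_group (cycle_group G n)"
  unfolding cycle_group_def by (rule comm_group_subgroup[OF comm_group_bar_chains subgroup_bar_cycles])

lemma carrier_cycle_group [simp]: "carrier (cycle_group G n) = bar_cycles G n"
  and mult_cycle_group [simp]: "x \<otimes>\<^bsub>cycle_group G n\<^esub> y = x + y"
  and one_cycle_group [simp]: "\<one>\<^bsub>cycle_group G n\<^esub> = 0"
  by (simp_all add: cycle_group_def)

lemma Z0n_eq_generate:
  "Z0n G n = generate (bar_chains G n) (antisymmetrized_bar G ` commuting_tuples G n)"
proof -
  have "{(\<Sum>\<sigma> | \<sigma> permutes {..<n}. frag_cmul (sign \<sigma>) (bar G (permute_list \<sigma> gs))) | gs.
      gs \<in> commuting_tuples G n} = antisymmetrized_bar G ` commuting_tuples G n"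
    by (auto simp: antisymmetrized_bar_def commuting_tuples_def image_iff)
  then show ?thesis
    by (simp add: Z0n_def)
qed

lemma antisymmetrized_bar_carrier:
  "antisymmetrized_bar G ` commuting_tuples G n \<subseteq> carrier (bar_chains G n)"
  using antisymmetrized_bar_in_chains by (fastforce simp: commuting_tuples_def)

lemma subgroup_Z0n: "subgroup (Z0n G n) (bar_chains G n)"
  unfolding Z0n_eq_generate by (rule C.generate_is_subgroup[OF antisymmetrized_bar_carrier])

lemma Z0n_subset_cycles:
  assumes "n \<ge> 1"
  shows "Z0n G n \<subseteq> bar_cycles G n"
proof -
  obtain m where n: "n = Suc m"
    using assms by (cases n) auto
  have "antisymmetrized_bar G ` commuting_tuples G n \<subseteq> bar_cycles G n"
    using antisymmetrized_bar_carrier[of n] bar_boundary_antisymmetrized[OF G.is_group, of _ m]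
    by (auto simp: bar_cycles_iff n)
  then show ?thesis
    unfolding Z0n_eq_generate by (rule C.generate_subgroup_incl[OF _ subgroup_bar_cycles])
qed

lemma subgroup_boundaries_cycle_group: "subgroup (bar_boundaries G n) (cycle_group G n)"
  unfolding cycle_group_def
  by (rule C.subgroup_incl[OF subgroup_bar_boundaries subgroup_bar_cycles bar_boundaries_subset_cycles])

lemma comm_group_group_homology: "comm_group (group_homology G n)"
  unfolding group_homology_def
  by (rule comm_group.abelian_FactGroup[OF comm_group_cycle_group subgroup_boundaries_cycle_group])

lemma cycle_group_projective:
  assumes "comm_group E" "group M" "p \<in> hom E M" "f \<in> hom (cycle_group G n) M"
    and "f ` bar_cycles G n \<subseteq> p ` carrier E"
  obtains t where "t \<in> hom (cycle_group G n) E" "\<And>z. z \<in> bar_cycles G n \<Longrightarrow> p (t z) = f z"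
  using subgroup_free_Abelian_group_projective[OF subgroup_bar_cycles[of n, unfolded bar_chains_def]
      assms(1-3) assms(4)[unfolded cycle_group_def bar_chains_def] assms(5)]
  unfolding cycle_group_def bar_chains_def by blast

definition trivial_cycles :: "nat \<Rightarrow> ('g list \<Rightarrow>\<^sub>0 int) set"
  where "trivial_cycles n = Z0n G n <#>\<^bsub>bar_chains G n\<^esub> bar_boundaries G n"

lemma H0n_eq: "H0n G n = cycle_group G n Mod trivial_cycles n"
  by (simp add: H0n_def trivial_cycles_def)

lemma subgroup_trivial_cycles:
  assumes "n \<ge> 1"
  shows "subgroup (trivial_cycles n) (cycle_group G n)"
proof -
  have "subgroup (trivial_cycles n) (bar_chains G n)"
    unfolding trivial_cycles_def by (rule C.mult_subgroups[OF subgroup_Z0n subgroup_bar_boundaries])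
  moreover have "trivial_cycles n \<subseteq> bar_cycles G n"
    using Z0n_subset_cycles[OF assms] bar_boundaries_subset_cycles[of n]
      subgroup.m_closed[OF subgroup_bar_cycles, of _ n]
    unfolding trivial_cycles_def set_mult_def by fastforce
  ultimately show ?thesis
    unfolding cycle_group_def by (rule C.subgroup_incl[OF _ subgroup_bar_cycles])
qed

text \<open>The group of boundaries is a subgroup of a free abelian group, hence projective, so the differential splits
over its image. This choice is what makes the splitting of the exact sequence non-canonical.\<close>

lemma boundary_section:
  obtains s where "s \<in> hom ((bar_chains G (n - 1))\<lparr>carrier := bar_boundary G n ` carrier (bar_chains G n)\<rparr>) (bar_chains G n)"
    and "\<And>b. b \<in> bar_boundary G n ` carrier (bar_chains G n) \<Longrightarrow> bar_boundary G n (s b) = b"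
proof -
  let ?B = "bar_boundary G n ` carrier (bar_chains G n)"
  have "subgroup ?B (bar_chains G (n - 1))"
    by (rule bd.img_is_subgroup)
  moreover have "(\<lambda>x. x) \<in> hom ((bar_chains G (n - 1))\<lparr>carrier := ?B\<rparr>) (bar_chains G (n - 1))"
    using bd.hom_closed by (auto simp: hom_def)
  ultimately show thesis
    using that subgroup_free_Abelian_group_projective[of ?B _ "bar_chains G n" "bar_chains G (n - 1)"
        "bar_boundary G n" "\<lambda>x. x"]
      bar_boundary_hom[OF G.is_group, of n] comm_group_bar_chains[of G n] C.is_group[of "n - 1"]
    unfolding bar_chains_def[of G "n - 1"] by blast
qed

text \<open>With a section \<open>s\<close> of the differential, \<open>c \<mapsto> c - s (\<partial> c)\<close> is a retraction of the chains onto the cycles. It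
extends homomorphisms from cycles to chains.\<close>

lemma boundary_splitting:
  obtains s where "s \<in> hom ((bar_chains G (n - 1))\<lparr>carrier := bar_boundary G n ` carrier (bar_chains G n)\<rparr>) (bar_chains G n)"
    and "(\<lambda>c. c - s (bar_boundary G n c)) \<in> hom (bar_chains G n) (cycle_group G n)"
    and "\<And>z. z \<in> bar_cycles G n \<Longrightarrow> z - s (bar_boundary G n z) = z"
proof -
  let ?B = "bar_boundary G n ` carrier (bar_chains G n)"
  obtain s where s: "s \<in> hom ((bar_chains G (n - 1))\<lparr>carrier := ?B\<rparr>) (bar_chains G n)"
    and sec: "\<And>b. b \<in> ?B \<Longrightarrow> bar_boundary G n (s b) = b"
    using boundary_section by blast
  have s_closed: "s b \<in> carrier (bar_chains G n)" if "b \<in> ?B" for b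
    using hom_in_carrier[OF s] that by simp
  have s_add: "s (a + b) = s a + s b" if "a \<in> ?B" "b \<in> ?B" for a b
    using hom_mult[OF s, of a b] that by simp
  have "(0 :: 'g list \<Rightarrow>\<^sub>0 int) \<in> ?B"
    using bar_boundary_zero[of n] C.one_closed[of n] by (metis bar_chains_one image_eqI)
  then have s_zero: "s 0 = 0"
    using s_add[of 0 0] by simp
  show thesis
  proof (rule that[OF s])
    show "(\<lambda>c. c - s (bar_boundary G n c)) \<in> hom (bar_chains G n) (cycle_group G n)"
    proof (rule homI)
      show "c - s (bar_boundary G n c) \<in> carrier (cycle_group G n)" if "c \<in> carrier (bar_chains G n)" for c
        using that sec s_closed by (simp add: bar_cycles_iff bar_boundary_diff bar_chains_diff)
    qed (simp add: bar_boundary_add s_add)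
  qed (simp add: bar_cycles_iff s_zero)
qed

section \<open>Cocycles and the group Utw\<close>

lemma comm_group_cochains: "comm_group (cochains G A n)"
  unfolding cochains_def by (rule comm_group_hom_group[OF C.is_group A.comm_group_axioms])

interpretation X: comm_group "cochains G A n" for n
  by (rule comm_group_cochains)

lemma cochain_hom: "\<omega> \<in> carrier (cochains G A n) \<Longrightarrow> \<omega> \<in> hom (bar_chains G n) A"
  by (simp add: cochains_def carrier_hom_group)

lemma cochain_closed:
  "\<omega> \<in> carrier (cochains G A n) \<Longrightarrow> c \<in> carrier (bar_chains G n) \<Longrightarrow> \<omega> c \<in> carrier A"
  using cochain_hom hom_in_carrier by fast

lemma cochain_add:
  "\<lbrakk>\<omega> \<in> carrier (cochains G A n); c \<in> carrier (bar_chains G n); d \<in> carrier (bar_chains G n)\<rbrakk>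
    \<Longrightarrow> \<omega> (c + d) = \<omega> c \<otimes>\<^bsub>A\<^esub> \<omega> d"
  using hom_mult[OF cochain_hom] by fastforce

lemma cochain_zero: "\<omega> \<in> carrier (cochains G A n) \<Longrightarrow> \<omega> 0 = \<one>\<^bsub>A\<^esub>"
  using hom_one[OF cochain_hom C.is_group A.is_group] by simp

lemma cochain_mult:
  "c \<in> carrier (bar_chains G n) \<Longrightarrow> (\<omega> \<otimes>\<^bsub>cochains G A n\<^esub> \<omega>') c = \<omega> c \<otimes>\<^bsub>A\<^esub> \<omega>' c"
  by (simp add: cochains_def hom_group_mult)

lemma coboundary_hom: "coboundary G n \<in> hom (cochains G A n) (cochains G A (n + 1))"
  using pullback_hom[OF C.is_group bar_boundary_hom[OF G.is_group], of "n + 1" A]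
  by (simp add: cochains_def coboundary_def[abs_def])

text \<open>As \<open>\<delta> \<omega> = \<omega> \<circ> \<partial>\<close>, a cochain is a cocycle iff it kills the boundaries.\<close>

lemma cocycles_iff:
  "\<omega> \<in> cocycles G A n \<longleftrightarrow> \<omega> \<in> carrier (cochains G A n) \<and> (\<forall>b\<in>bar_boundaries G n. \<omega> b = \<one>\<^bsub>A\<^esub>)"
proof -
  have "coboundary G n \<omega> = \<one>\<^bsub>cochains G A (n + 1)\<^esub> \<longleftrightarrow> (\<forall>b\<in>bar_boundaries G n. \<omega> b = \<one>\<^bsub>A\<^esub>)"
    by (auto simp: coboundary_def cochains_def hom_group_def bar_boundaries_def fun_eq_iff restrict_def)
  then show ?thesis
    by (simp add: cocycles_def kernel_def)
qed

lemma coboundaries_cycles: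
  assumes "n \<ge> 1" "\<eta> \<in> coboundaries G A n" "z \<in> bar_cycles G n"
  shows "\<eta> z = \<one>\<^bsub>A\<^esub>"
proof -
  obtain \<phi> where "\<phi> \<in> carrier (cochains G A (n - 1))" "\<eta> = coboundary G (n - 1) \<phi>"
    using assms(1,2) by (auto simp: coboundaries_def split: if_splits)
  then show ?thesis
    using assms(1,3) by (simp add: coboundary_def bar_cycles_iff cochain_zero)
qed

lemma subgroup_coboundaries:
  assumes "n \<ge> 1"
  shows "subgroup (coboundaries G A n) (cochains G A n)"
proof -
  have "group_hom (cochains G A (n - 1)) (cochains G A n) (coboundary G (n - 1))"
    using coboundary_hom[of "n - 1"] assms by (simp add: group_hom_def group_hom_axioms_def X.is_group)
  then show ?thesis
    using assms group_hom.img_is_subgroup by (auto simp: coboundaries_def)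
qed

text \<open>By additivity of \<open>\<omega>\<close>, the alternating sum of its values in the definition of \<open>Utw\<close> is its value at the
antisymmetrized tuple. Thus the \<open>Utw\<close> condition says that \<open>\<omega>\<close> kills \<open>Z0n\<close>.\<close>

lemma cochain_antisymmetrized:
  assumes \<omega>: "\<omega> \<in> carrier (cochains G A n)" and gs: "gs \<in> commuting_tuples G n"
  shows "(\<Otimes>\<^bsub>A\<^esub>\<sigma>\<in>{\<sigma>. \<sigma> permutes {..<n}}. \<omega> (bar G (permute_list \<sigma> gs)) [^]\<^bsub>A\<^esub> sign \<sigma>)
    = \<omega> (antisymmetrized_bar G gs)"
proof -
  let ?S = "{gs. length gs = n \<and> set gs \<subseteq> carrier G - {\<one>\<^bsub>G\<^esub>}}"
  have len: "length gs = n" and sub: "set gs \<subseteq> carrier G"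
    using gs by (auto simp: commuting_tuples_def)
  have h: "\<omega> \<in> hom (free_Abelian_group ?S) A"
    using cochain_hom[OF \<omega>] by (simp add: bar_chains_def)
  have bar: "bar G (permute_list \<sigma> gs) \<in> carrier (free_Abelian_group ?S)" if "\<sigma> permutes {..<n}" for \<sigma>
    using bar_in_chains[of "permute_list \<sigma> gs" G n] that len sub by (simp add: bar_chains_def)
  have pow: "\<omega> (frag_cmul k x) = \<omega> x [^]\<^bsub>A\<^esub> k" if "x \<in> carrier (free_Abelian_group ?S)" for x k
    using hom_int_pow[OF h that, of k] that by (simp add: A.is_group)
  have "\<omega> (antisymmetrized_bar G gs)
    = (\<Otimes>\<^bsub>A\<^esub>\<sigma>\<in>{\<sigma>. \<sigma> permutes {..<n}}. \<omega> (frag_cmul (sign \<sigma>) (bar G (permute_list \<sigma> gs))))"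
    unfolding antisymmetrized_bar_def len
  proof (rule hom_sum_free_Abelian_group[OF A.comm_group_axioms h])
    fix \<sigma> assume "\<sigma> \<in> {\<sigma>. \<sigma> permutes {..<n}}"
    then show "frag_cmul (sign \<sigma>) (bar G (permute_list \<sigma> gs)) \<in> carrier (free_Abelian_group ?S)"
      using bar[of \<sigma>] keys_cmul[of "sign \<sigma>" "bar G (permute_list \<sigma> gs)"] by auto
  qed (simp add: finite_permutations)
  also have "\<dots> = (\<Otimes>\<^bsub>A\<^esub>\<sigma>\<in>{\<sigma>. \<sigma> permutes {..<n}}. \<omega> (bar G (permute_list \<sigma> gs)) [^]\<^bsub>A\<^esub> sign \<sigma>)"
    using bar hom_in_carrier[OF h] by (intro A.finprod_cong refl) (auto simp: pow simp_implies_def)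
  finally show ?thesis ..
qed

definition Utw_cocycles :: "nat \<Rightarrow> (('g list \<Rightarrow>\<^sub>0 int) \<Rightarrow> 'a) set"
  where "Utw_cocycles n = {\<omega> \<in> cocycles G A n. \<forall>z\<in>Z0n G n. \<omega> z = \<one>\<^bsub>A\<^esub>}"

lemma Utw_cocycles_cochains: "\<omega> \<in> Utw_cocycles n \<Longrightarrow> \<omega> \<in> carrier (cochains G A n)"
  by (simp add: Utw_cocycles_def cocycles_iff)

lemma vanishes_on_Z0n_iff:
  assumes "\<omega> \<in> carrier (cochains G A n)"
  shows "(\<forall>z\<in>Z0n G n. \<omega> z = \<one>\<^bsub>A\<^esub>) \<longleftrightarrow>
    (\<forall>gs\<in>commuting_tuples G n. \<omega> (antisymmetrized_bar G gs) = \<one>\<^bsub>A\<^esub>)"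
proof
  have "antisymmetrized_bar G ` commuting_tuples G n \<subseteq> Z0n G n"
    unfolding Z0n_eq_generate using generate.incl by (rule subsetI)
  then show "\<forall>gs\<in>commuting_tuples G n. \<omega> (antisymmetrized_bar G gs) = \<one>\<^bsub>A\<^esub>"
    if "\<forall>z\<in>Z0n G n. \<omega> z = \<one>\<^bsub>A\<^esub>"
    using that by blast
next
  assume *: "\<forall>gs\<in>commuting_tuples G n. \<omega> (antisymmetrized_bar G gs) = \<one>\<^bsub>A\<^esub>"
  have "group_hom (bar_chains G n) A \<omega>"
    using cochain_hom[OF assms] by (simp add: group_hom_def group_hom_axioms_def C.is_group A.is_group)
  then have "subgroup (kernel (bar_chains G n) A \<omega>) (bar_chains G n)"
    by (rule group_hom.subgroup_kernel)
  moreover have "antisymmetrized_bar G ` commuting_tuples G n \<subseteq> kernel (bar_chains G n) A \<omega>"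
    using * antisymmetrized_bar_carrier by (auto simp: kernel_def)
  ultimately have "Z0n G n \<subseteq> kernel (bar_chains G n) A \<omega>"
    unfolding Z0n_eq_generate by (intro C.generate_subgroup_incl)
  then show "\<forall>z\<in>Z0n G n. \<omega> z = \<one>\<^bsub>A\<^esub>"
    by (auto simp: kernel_def)
qed

text \<open>\<open>Utw\<close> as a quotient of a group of cocycles, which makes its group structure and the homomorphism property of
\<open>cohomology_class\<close> instances of general facts on quotients.\<close>

lemma Utw_eq: "Utw G A n = (cochains G A n)\<lparr>carrier := Utw_cocycles n\<rparr> Mod coboundaries G A n"
proof -
  have "\<omega> \<in> cocycles G A n \<and> (\<forall>gs\<in>commuting_tuples G n.
      (\<Otimes>\<^bsub>A\<^esub>\<sigma>\<in>{\<sigma>. \<sigma> permutes {..<n}}. \<omega> (bar G (permute_list \<sigma> gs)) [^]\<^bsub>A\<^esub> sign \<sigma>) = \<one>\<^bsub>A\<^esub>)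
    \<longleftrightarrow> \<omega> \<in> Utw_cocycles n" for \<omega>
    using cochain_antisymmetrized[of \<omega> n] vanishes_on_Z0n_iff[of \<omega> n]
    by (auto simp: Utw_cocycles_def cocycles_iff)
  then show ?thesis
    by (simp add: Utw_def group_cohomology_def FactGroup_def RCOSETS_def cohomology_class_def)
      (auto simp: set_mult_def fun_eq_iff)
qed

lemma subgroup_Utw_cocycles: "subgroup (Utw_cocycles n) (cochains G A n)"
proof -
  have chains: "z \<in> carrier (bar_chains G n)" if "z \<in> Z0n G n \<or> z \<in> bar_boundaries G n" for z
    using that subgroup.subset[OF subgroup_Z0n] subgroup.subset[OF subgroup_bar_boundaries] by blast
  have mem: "\<omega> \<in> Utw_cocycles n \<longleftrightarrow> \<omega> \<in> carrier (cochains G A n) \<and>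
      (\<forall>z. z \<in> Z0n G n \<or> z \<in> bar_boundaries G n \<longrightarrow> \<omega> z = \<one>\<^bsub>A\<^esub>)" for \<omega>
    by (auto simp: Utw_cocycles_def cocycles_iff)
  show ?thesis
  proof (rule subgroup.intro)
    show "inv\<^bsub>cochains G A n\<^esub> \<omega> \<in> Utw_cocycles n" if "\<omega> \<in> Utw_cocycles n" for \<omega>
      using that chains hom_group_inv[OF C.is_group A.comm_group_axioms, of \<omega> n] X.inv_closed[of \<omega> n]
      by (simp add: mem flip: cochains_def)
    show "\<one>\<^bsub>cochains G A n\<^esub> \<in> Utw_cocycles n"
      using X.one_closed[of n] chains by (simp add: mem cochains_def hom_group_one)
  qed (use chains in \<open>auto simp: mem cochain_mult\<close>)
qed

text \<open>Coboundaries kill all cycles, in particular those in \<open>Z0n\<close>. Therefore the \<open>Utw\<close> condition depends only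
on the cohomology class.\<close>

lemma coboundaries_subset_Utw_cocycles:
  assumes "n \<ge> 1"
  shows "coboundaries G A n \<subseteq> Utw_cocycles n"
  using coboundaries_cycles[OF assms] subgroup.subset[OF subgroup_coboundaries[OF assms]]
    Z0n_subset_cycles[OF assms] bar_boundaries_subset_cycles[of n]
  by (auto simp: Utw_cocycles_def cocycles_iff subset_iff)

lemma comm_group_Utw:
  assumes "n \<ge> 1"
  shows "comm_group (Utw G A n)"
proof -
  have "subgroup (coboundaries G A n) ((cochains G A n)\<lparr>carrier := Utw_cocycles n\<rparr>)"
    by (rule X.subgroup_incl[OF subgroup_coboundaries subgroup_Utw_cocycles
          coboundaries_subset_Utw_cocycles]) (rule assms)+
  then show ?thesis
    unfolding Utw_eq using comm_group_subgroup[OF comm_group_cochains subgroup_Utw_cocycles]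
    by (rule comm_group.abelian_FactGroup[rotated])
qed

lemma carrier_Utw: "carrier (Utw G A n) = cohomology_class G A n ` Utw_cocycles n"
  by (auto simp: Utw_eq carrier_FactGroup cohomology_class_def)

lemma one_Utw: "\<one>\<^bsub>Utw G A n\<^esub> = coboundaries G A n"
  by (simp add: Utw_eq)

lemma cohomology_class_hom:
  assumes "n \<ge> 1"
  shows "cohomology_class G A n \<in> hom ((cochains G A n)\<lparr>carrier := Utw_cocycles n\<rparr>) (Utw G A n)"
proof -
  have "coboundaries G A n \<lhd> (cochains G A n)\<lparr>carrier := Utw_cocycles n\<rparr>"
    using X.subgroup_incl[OF subgroup_coboundaries subgroup_Utw_cocycles
        coboundaries_subset_Utw_cocycles] assms
    by (intro comm_group.subgroup_imp_normal comm_group_subgroup comm_group_cochains subgroup_Utw_cocycles)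
      auto
  from normal.r_coset_hom_Mod[OF this] show ?thesis
    by (simp add: Utw_eq cohomology_class_def[abs_def])
qed

lemma cohomology_class_eq_one_iff:
  assumes "n \<ge> 1" "\<omega> \<in> carrier (cochains G A n)"
  shows "cohomology_class G A n \<omega> = \<one>\<^bsub>Utw G A n\<^esub> \<longleftrightarrow> \<omega> \<in> coboundaries G A n"
  unfolding one_Utw cohomology_class_def
  using X.coset_join1[OF _ assms(2) subgroup_coboundaries[OF assms(1)]]
    X.coset_join2[OF assms(2) subgroup_coboundaries[OF assms(1)]] by blast

lemma Utw_cocycle_trivial_cycles:
  assumes "\<omega> \<in> Utw_cocycles n" "z \<in> trivial_cycles n"
  shows "\<omega> z = \<one>\<^bsub>A\<^esub>"
proof -
  obtain a b where ab: "z = a + b" "a \<in> Z0n G n" "b \<in> bar_boundaries G n"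
    using assms(2) by (auto simp: trivial_cycles_def set_mult_def)
  then have "a \<in> carrier (bar_chains G n)" "b \<in> carrier (bar_chains G n)"
    using subgroup.subset[OF subgroup_Z0n] subgroup.subset[OF subgroup_bar_boundaries] by blast+
  then show ?thesis
    using assms(1) ab cochain_add[OF Utw_cocycles_cochains[OF assms(1)]]
    by (simp add: Utw_cocycles_def cocycles_iff)
qed

section \<open>The exact sequence and its splitting\<close>

lemma cycles_chains: "z \<in> bar_cycles G n \<Longrightarrow> z \<in> carrier (bar_chains G n)"
  by (simp add: bar_cycles_iff)

lemma carrier_H0n:
  "carrier (H0n G n) = (\<lambda>z. trivial_cycles n #>\<^bsub>cycle_group G n\<^esub> z) ` bar_cycles G n"
  by (simp add: H0n_eq carrier_FactGroup)

text \<open>Neither adding a coboundary to \<open>\<omega>\<close> nor adding a trivial cycle to \<open>z\<close> changes the value, so the set of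
values in the definition of \<open>rho_tilde\<close> is a singleton.\<close>

lemma rho_tilde_class:
  assumes n: "n \<ge> 1" and \<omega>: "\<omega> \<in> Utw_cocycles n" and z: "z \<in> bar_cycles G n"
  shows "rho_tilde G n (cohomology_class G A n \<omega>) (trivial_cycles n #>\<^bsub>cycle_group G n\<^esub> z) = \<omega> z"
proof -
  let ?X = "cohomology_class G A n \<omega>" and ?Y = "trivial_cycles n #>\<^bsub>cycle_group G n\<^esub> z"
  interpret T: subgroup "trivial_cycles n" "cycle_group G n"
    by (rule subgroup_trivial_cycles[OF n])
  interpret Z: comm_group "cycle_group G n"
    by (rule comm_group_cycle_group)
  have \<omega>_in: "\<omega> \<in> ?X"
    unfolding cohomology_class_def
    by (rule X.rcos_self[OF Utw_cocycles_cochains[OF \<omega>] subgroup_coboundaries[OF n]])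
  have z_in: "z \<in> ?Y"
    using z by (intro Z.rcos_self T.subgroup_axioms) simp
  have "\<omega>' z' = \<omega> z" if "\<omega>' \<in> ?X" "z' \<in> ?Y" for \<omega>' z'
  proof -
    obtain \<eta> where \<eta>: "\<eta> \<in> coboundaries G A n" "\<omega>' = \<eta> \<otimes>\<^bsub>cochains G A n\<^esub> \<omega>"
      using \<open>\<omega>' \<in> ?X\<close> by (auto simp: cohomology_class_def r_coset_def)
    obtain m where m: "m \<in> trivial_cycles n" "z' = m + z"
      using \<open>z' \<in> ?Y\<close> by (auto simp: r_coset_def)
    have m_cyc: "m \<in> bar_cycles G n"
      using m(1) T.subset by auto
    have z'_cyc: "z' \<in> bar_cycles G n"
      using Z.m_closed[of m z] m_cyc z m(2) by simp
    have "\<omega>' z' = \<omega> z'"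
      using coboundaries_cycles[OF n \<eta>(1) z'_cyc] cycles_chains[OF z'_cyc]
        cochain_closed[OF Utw_cocycles_cochains[OF \<omega>]] by (simp add: \<eta>(2) cochain_mult)
    also have "\<dots> = \<omega> z"
      using Utw_cocycle_trivial_cycles[OF \<omega> m(1)] cochain_add[OF Utw_cocycles_cochains[OF \<omega>]]
        cochain_closed[OF Utw_cocycles_cochains[OF \<omega>]] cycles_chains m_cyc z
      by (simp add: m(2))
    finally show ?thesis .
  qed
  then have "{\<omega> z |\<omega> z. \<omega> \<in> ?X \<and> z \<in> ?Y} = {\<omega> z}"
    using \<omega>_in z_in by blast
  then show ?thesis
    using z by (simp add: rho_tilde_def carrier_H0n)
qed

lemma comm_group_H0n: "n \<ge> 1 \<Longrightarrow> comm_group (H0n G n)"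
  unfolding H0n_eq by (rule comm_group.abelian_FactGroup[OF comm_group_cycle_group subgroup_trivial_cycles])

lemma mult_H0n:
  assumes "n \<ge> 1" "z \<in> bar_cycles G n" "z' \<in> bar_cycles G n"
  shows "(trivial_cycles n #>\<^bsub>cycle_group G n\<^esub> z) \<otimes>\<^bsub>H0n G n\<^esub> (trivial_cycles n #>\<^bsub>cycle_group G n\<^esub> z')
    = trivial_cycles n #>\<^bsub>cycle_group G n\<^esub> (z + z')"
  using normal.rcos_sum[OF comm_group.subgroup_imp_normal[OF comm_group_cycle_group
        subgroup_trivial_cycles[OF assms(1)]], of z z'] assms(2,3)
  by (simp add: H0n_eq)

lemma rho_tilde_in_hom_group:
  assumes n: "n \<ge> 1" and X: "X \<in> carrier (Utw G A n)"
  shows "rho_tilde G n X \<in> carrier (hom_group (H0n G n) A)"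
proof -
  obtain \<omega> where \<omega>: "\<omega> \<in> Utw_cocycles n" "X = cohomology_class G A n \<omega>"
    using X by (auto simp: carrier_Utw)
  have cyc_add: "z + z' \<in> bar_cycles G n" if "z \<in> bar_cycles G n" "z' \<in> bar_cycles G n" for z z'
    using subgroup.m_closed[OF subgroup_bar_cycles that] by simp
  have "rho_tilde G n X \<in> hom (H0n G n) A"
  proof (rule homI)
    show "rho_tilde G n X Y \<in> carrier A" if "Y \<in> carrier (H0n G n)" for Y
      using that n \<omega> cochain_closed[OF Utw_cocycles_cochains] cycles_chains
      by (auto simp: carrier_H0n rho_tilde_class)
    show "rho_tilde G n X (Y \<otimes>\<^bsub>H0n G n\<^esub> Y') = rho_tilde G n X Y \<otimes>\<^bsub>A\<^esub> rho_tilde G n X Y'"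
      if "Y \<in> carrier (H0n G n)" "Y' \<in> carrier (H0n G n)" for Y Y'
      using that n \<omega> cochain_add[OF Utw_cocycles_cochains[OF \<omega>(1)]] cycles_chains
      by (auto simp: carrier_H0n rho_tilde_class mult_H0n cyc_add)
  qed
  moreover have "rho_tilde G n X \<in> extensional (carrier (H0n G n))"
    by (simp add: rho_tilde_def)
  ultimately show ?thesis
    by (simp add: carrier_hom_group)
qed

lemma cohomology_class_mult:
  assumes "n \<ge> 1" "\<omega> \<in> Utw_cocycles n" "\<omega>' \<in> Utw_cocycles n"
  shows "cohomology_class G A n \<omega> \<otimes>\<^bsub>Utw G A n\<^esub> cohomology_class G A n \<omega>'
    = cohomology_class G A n (\<omega> \<otimes>\<^bsub>cochains G A n\<^esub> \<omega>')"
  using hom_mult[OF cohomology_class_hom[OF assms(1)], of \<omega> \<omega>'] assms(2,3) by simp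

lemma rho_tilde_hom:
  assumes n: "n \<ge> 1"
  shows "rho_tilde G n \<in> hom (Utw G A n) (hom_group (H0n G n) A)"
proof (rule homI)
  interpret U: comm_group "Utw G A n"
    by (rule comm_group_Utw[OF n])
  interpret R: comm_group "hom_group (H0n G n) A"
    by (rule comm_group_hom_group[OF comm_group.axioms(2)[OF comm_group_H0n[OF n]] A.comm_group_axioms])
  fix X X' assume X: "X \<in> carrier (Utw G A n)" "X' \<in> carrier (Utw G A n)"
  then obtain \<omega> \<omega>' where \<omega>: "\<omega> \<in> Utw_cocycles n" "X = cohomology_class G A n \<omega>"
    "\<omega>' \<in> Utw_cocycles n" "X' = cohomology_class G A n \<omega>'"
    by (auto simp: carrier_Utw)
  have prod: "\<omega> \<otimes>\<^bsub>cochains G A n\<^esub> \<omega>' \<in> Utw_cocycles n"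
    using subgroup.m_closed[OF subgroup_Utw_cocycles] \<omega> by blast
  show "rho_tilde G n (X \<otimes>\<^bsub>Utw G A n\<^esub> X') = rho_tilde G n X \<otimes>\<^bsub>hom_group (H0n G n) A\<^esub> rho_tilde G n X'"
  proof (rule hom_group_eqI)
    show "rho_tilde G n (X \<otimes>\<^bsub>Utw G A n\<^esub> X') \<in> carrier (hom_group (H0n G n) A)"
      using X by (intro rho_tilde_in_hom_group[OF n]) simp
    show "rho_tilde G n X \<otimes>\<^bsub>hom_group (H0n G n) A\<^esub> rho_tilde G n X' \<in> carrier (hom_group (H0n G n) A)"
      using X rho_tilde_in_hom_group[OF n] by simp
    fix Y assume Y: "Y \<in> carrier (H0n G n)"
    then obtain z where z: "z \<in> bar_cycles G n" "Y = trivial_cycles n #>\<^bsub>cycle_group G n\<^esub> z"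
      by (auto simp: carrier_H0n)
    show "rho_tilde G n (X \<otimes>\<^bsub>Utw G A n\<^esub> X') Y = (rho_tilde G n X \<otimes>\<^bsub>hom_group (H0n G n) A\<^esub> rho_tilde G n X') Y"
      using n \<omega> z prod Y
      by (simp add: hom_group_mult cohomology_class_mult rho_tilde_class cochain_mult cycles_chains)
  qed
qed (rule rho_tilde_in_hom_group[OF n])

lemma rho_tilde_eq_one_iff:
  assumes n: "n \<ge> 1" and \<omega>: "\<omega> \<in> Utw_cocycles n"
  shows "rho_tilde G n (cohomology_class G A n \<omega>) = \<one>\<^bsub>hom_group (H0n G n) A\<^esub> \<longleftrightarrow>
    (\<forall>z\<in>bar_cycles G n. \<omega> z = \<one>\<^bsub>A\<^esub>)"
proof -
  interpret R: comm_group "hom_group (H0n G n) A"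
    by (rule comm_group_hom_group[OF comm_group.axioms(2)[OF comm_group_H0n[OF n]] A.comm_group_axioms])
  have "cohomology_class G A n \<omega> \<in> carrier (Utw G A n)"
    using \<omega> by (simp add: carrier_Utw)
  then have "rho_tilde G n (cohomology_class G A n \<omega>) = \<one>\<^bsub>hom_group (H0n G n) A\<^esub> \<longleftrightarrow>
    (\<forall>Y\<in>carrier (H0n G n). rho_tilde G n (cohomology_class G A n \<omega>) Y = \<one>\<^bsub>A\<^esub>)"
    using hom_group_eqI[OF rho_tilde_in_hom_group[OF n] R.one_closed] hom_group_one by metis
  then show ?thesis
    by (simp add: carrier_H0n rho_tilde_class[OF n \<omega>])
qed

text \<open>A homomorphism on \<open>H0n\<close> is pulled back along the chain retraction onto the cycles followed by the projection to \<open>H0n\<close>.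
The resulting cochain kills the boundaries and \<open>Z0n\<close>, so it represents a class in \<open>Utw\<close>; and since the retraction fixes
cycles, \<open>rho_tilde\<close> gives the homomorphism back.\<close>

lemma rho_tilde_has_section:
  assumes n: "n \<ge> 1"
  shows "has_section (Utw G A n) (hom_group (H0n G n) A) (rho_tilde G n)"
proof -
  obtain s where \<pi>: "(\<lambda>c. c - s (bar_boundary G n c)) \<in> hom (bar_chains G n) (cycle_group G n)"
    and \<pi>_id: "\<And>z. z \<in> bar_cycles G n \<Longrightarrow> z - s (bar_boundary G n z) = z"
    by (rule boundary_splitting[of n]) (rule that)
  define q where "q c = trivial_cycles n #>\<^bsub>cycle_group G n\<^esub> (c - s (bar_boundary G n c))" for c
  interpret Z: comm_group "cycle_group G n"
    by (rule comm_group_cycle_group)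
  interpret T: normal "trivial_cycles n" "cycle_group G n"
    by (rule comm_group.subgroup_imp_normal[OF comm_group_cycle_group subgroup_trivial_cycles[OF n]])
  have q: "q \<in> hom (bar_chains G n) (H0n G n)"
    using hom_compose[OF \<pi> T.r_coset_hom_Mod] by (simp add: q_def[abs_def] H0n_eq o_def)
  have q_trivial: "q z = \<one>\<^bsub>H0n G n\<^esub>" if "z \<in> trivial_cycles n" for z
    using that T.subset Z.coset_join2[OF _ T.subgroup_axioms] \<pi>_id by (auto simp: q_def H0n_eq)
  have zero_triv: "0 \<in> Z0n G n" "0 \<in> bar_boundaries G n"
    using subgroup.one_closed[OF subgroup_Z0n] subgroup.one_closed[OF subgroup_bar_boundaries] by auto
  have triv: "z \<in> trivial_cycles n" if "z \<in> Z0n G n \<or> z \<in> bar_boundaries G n" for z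
    using that zero_triv by (force simp: trivial_cycles_def set_mult_def)
  define \<Sigma> where "\<Sigma> = (\<lambda>f :: ('g list \<Rightarrow>\<^sub>0 int) set \<Rightarrow> 'a. \<lambda>c\<in>carrier (bar_chains G n). f (q c))"
  have \<Sigma>: "\<Sigma> \<in> hom (hom_group (H0n G n) A) (cochains G A n)"
    unfolding \<Sigma>_def cochains_def by (rule pullback_hom[OF C.is_group q])
  have chains: "z \<in> carrier (bar_chains G n)" if "z \<in> Z0n G n \<or> z \<in> bar_boundaries G n" for z
    using that subgroup.subset[OF subgroup_Z0n] subgroup.subset[OF subgroup_bar_boundaries] by blast
  have \<Sigma>_Utw: "\<Sigma> f \<in> Utw_cocycles n" if f: "f \<in> carrier (hom_group (H0n G n) A)" for f
  proof -
    have "f \<one>\<^bsub>H0n G n\<^esub> = \<one>\<^bsub>A\<^esub>"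
      using f comm_group_H0n[OF n] by (intro hom_one) (auto simp: carrier_hom_group comm_group_def A.is_group)
    then have "\<Sigma> f z = \<one>\<^bsub>A\<^esub>" if "z \<in> Z0n G n \<or> z \<in> bar_boundaries G n" for z
      using chains[OF that] q_trivial[OF triv[OF that]] by (simp add: \<Sigma>_def)
    then show ?thesis
      using hom_in_carrier[OF \<Sigma> f] by (simp add: Utw_cocycles_def cocycles_iff)
  qed
  have "\<Sigma> \<in> hom (hom_group (H0n G n) A) ((cochains G A n)\<lparr>carrier := Utw_cocycles n\<rparr>)"
    using \<Sigma> \<Sigma>_Utw by (auto simp: hom_def)
  from hom_compose[OF this cohomology_class_hom[OF n]]
  have "(\<lambda>f. cohomology_class G A n (\<Sigma> f)) \<in> hom (hom_group (H0n G n) A) (Utw G A n)"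
    by (simp add: o_def)
  moreover have "rho_tilde G n (cohomology_class G A n (\<Sigma> f)) = f"
    if f: "f \<in> carrier (hom_group (H0n G n) A)" for f
  proof (rule hom_group_eqI[OF rho_tilde_in_hom_group[OF n] f])
    show "cohomology_class G A n (\<Sigma> f) \<in> carrier (Utw G A n)"
      using \<Sigma>_Utw[OF f] by (simp add: carrier_Utw)
    fix Y assume "Y \<in> carrier (H0n G n)"
    then obtain z where z: "z \<in> bar_cycles G n" "Y = trivial_cycles n #>\<^bsub>cycle_group G n\<^esub> z"
      by (auto simp: carrier_H0n)
    then show "rho_tilde G n (cohomology_class G A n (\<Sigma> f)) Y = f Y"
      using rho_tilde_class[OF n \<Sigma>_Utw[OF f] z(1)] by (simp add: \<Sigma>_def cycles_chains q_def \<pi>_id)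
  qed
  ultimately show ?thesis
    unfolding has_section_def by (intro bexI[of _ "\<lambda>f. cohomology_class G A n (\<Sigma> f)"] ballI)
qed

text \<open>If \<open>\<phi>\<close> on the boundaries \<open>B\<close> of degree \<open>n - 1\<close> extends to the cycles, then it extends further to all chains by the retraction, and
\<open>\<phi> \<circ> \<partial>\<close> is the coboundary of the extension. Conversely, \<open>\<phi> \<circ> \<partial> = \<psi> \<circ> \<partial>\<close> means that \<open>\<psi>\<close> extends \<open>\<phi>\<close>.
This gives injectivity on the cokernel. For the image: a cocycle \<open>\<omega>\<close> that kills the cycles is \<open>(\<omega> \<circ> s) \<circ> \<partial>\<close> for
any section \<open>s\<close> of the differential.\<close>

lemma iota_coker_exact:
  assumes n: "n \<ge> 1"
  defines "Q \<equiv> res_coker (cycle_group G (n - 1)) (bar_boundaries G (n - 1)) A"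
  shows "iota_coker G A n \<in> mon Q (Utw G A n)"
    and "iota_coker G A n ` carrier Q = kernel (Utw G A n) (hom_group (H0n G n) A) (rho_tilde G n)"
proof -
  let ?m = "n - 1"
  define P where "P = cycle_group G ?m"
  define B where "B = bar_boundaries G ?m"
  have B_eq: "B = bar_boundary G n ` carrier (bar_chains G n)"
    using n by (simp add: B_def bar_boundaries_def)
  have PB: "P\<lparr>carrier := B\<rparr> = (bar_chains G ?m)\<lparr>carrier := B\<rparr>"
    by (simp add: P_def cycle_group_def)
  interpret P: comm_group P
    unfolding P_def by (rule comm_group_cycle_group)
  have B: "subgroup B P"
    unfolding P_def B_def by (rule subgroup_boundaries_cycle_group)
  have PBg: "group (P\<lparr>carrier := B\<rparr>)"
    by (rule subgroup.subgroup_is_group[OF B P.is_group])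
  define \<Gamma> where "\<Gamma> = hom_group (P\<lparr>carrier := B\<rparr>) A"
  interpret \<Gamma>: comm_group \<Gamma>
    unfolding \<Gamma>_def by (rule comm_group_hom_group[OF PBg A.comm_group_axioms])
  define N where "N = res_image P B A"
  have Q: "Q = \<Gamma> Mod N"
    by (simp add: Q_def res_coker_def \<Gamma>_def N_def P_def B_def)
  have nN: "N \<lhd> \<Gamma>"
    unfolding \<Gamma>.normal_iff_subgroup unfolding \<Gamma>_def N_def
    by (rule subgroup_res_image[OF P.is_group B A.comm_group_axioms])
  interpret U: comm_group "Utw G A n"
    by (rule comm_group_Utw[OF n])

  define pull where "pull = (\<lambda>\<phi> :: ('g list \<Rightarrow>\<^sub>0 int) \<Rightarrow> 'a. \<lambda>c\<in>carrier (bar_chains G n). \<phi> (bar_boundary G n c))"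
  have "bar_boundary G n \<in> hom (bar_chains G n) (P\<lparr>carrier := B\<rparr>)"
    using bd.hom_mult[of _ n] by (auto simp: hom_def P_def B_eq)
  from pullback_hom[OF C.is_group this]
  have pull: "pull \<in> hom \<Gamma> (cochains G A n)"
    by (simp add: pull_def \<Gamma>_def cochains_def)
  have pull_cycles: "pull \<phi> z = \<one>\<^bsub>A\<^esub>" if \<phi>: "\<phi> \<in> carrier \<Gamma>" and z: "z \<in> bar_cycles G n" for \<phi> z
  proof -
    have "\<phi> \<one>\<^bsub>P\<lparr>carrier := B\<rparr>\<^esub> = \<one>\<^bsub>A\<^esub>"
      using \<phi> by (intro hom_one[OF _ PBg A.is_group]) (simp add: \<Gamma>_def carrier_hom_group)
    then show ?thesis
      using z by (simp add: pull_def bar_cycles_iff P_def)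
  qed
  have pull_Utw: "pull \<phi> \<in> Utw_cocycles n" if "\<phi> \<in> carrier \<Gamma>" for \<phi>
    using hom_in_carrier[OF pull that] pull_cycles[OF that] Z0n_subset_cycles[OF n]
      bar_boundaries_subset_cycles[of n] by (auto simp: Utw_cocycles_def cocycles_iff)
  have "pull \<in> hom \<Gamma> ((cochains G A n)\<lparr>carrier := Utw_cocycles n\<rparr>)"
    using pull pull_Utw by (auto simp: hom_def)
  from hom_compose[OF this cohomology_class_hom[OF n]]
  have g: "(\<lambda>\<phi>. cohomology_class G A n (pull \<phi>)) \<in> hom \<Gamma> (Utw G A n)" (is "?g \<in> _")
    by (simp add: o_def)
  have iota: "iota_coker G A n = (\<lambda>X. the_elem (?g ` X))"
    by (simp add: iota_coker_def[abs_def] pull_def)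
  have g_one_iff: "?g \<phi> = \<one>\<^bsub>Utw G A n\<^esub> \<longleftrightarrow> pull \<phi> \<in> coboundaries G A n" if "\<phi> \<in> carrier \<Gamma>" for \<phi>
    by (rule cohomology_class_eq_one_iff[OF n hom_in_carrier[OF pull that]])

  have g_N: "?g \<phi> = \<one>\<^bsub>Utw G A n\<^esub>" if \<phi>: "\<phi> \<in> N" for \<phi>
  proof -
    obtain \<psi> where \<psi>: "\<psi> \<in> carrier (hom_group P A)" "\<phi> = restrict \<psi> B"
      using \<phi> by (auto simp: N_def res_image_def)
    obtain s where "(\<lambda>c. c - s (bar_boundary G ?m c)) \<in> hom (bar_chains G ?m) (cycle_group G ?m)"
      and \<pi>_id: "\<And>z. z \<in> bar_cycles G ?m \<Longrightarrow> z - s (bar_boundary G ?m z) = z"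
      by (rule boundary_splitting[of ?m]) (rule that)
    then have \<pi>: "(\<lambda>c. c - s (bar_boundary G ?m c)) \<in> hom (bar_chains G ?m) P"
      unfolding P_def by blast
    let ?\<psi> = "\<lambda>c\<in>carrier (bar_chains G ?m). \<psi> (c - s (bar_boundary G ?m c))"
    have ext: "?\<psi> \<in> carrier (cochains G A ?m)"
      unfolding cochains_def by (rule pullback_in_hom_group[OF C.is_group \<pi> \<psi>(1)])
    have "pull \<phi> c = coboundary G ?m ?\<psi> c" for c
    proof (cases "c \<in> carrier (bar_chains G n)")
      case True
      then have b: "bar_boundary G n c \<in> B"
        by (simp add: B_eq)
      then have z: "bar_boundary G n c \<in> bar_cycles G ?m"
        using bar_boundaries_subset_cycles by (auto simp: B_def)
      show ?thesis
        using True b z n \<pi>_id[OF z] by (simp add: pull_def \<psi>(2) coboundary_def cycles_chains)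
    qed (use n in \<open>simp add: pull_def coboundary_def\<close>)
    then have "pull \<phi> = coboundary G ?m ?\<psi>"
      by blast
    then have "pull \<phi> \<in> coboundaries G A n"
      using ext n by (simp add: coboundaries_def)
    moreover have "\<phi> \<in> carrier \<Gamma>"
      using \<phi> normal_imp_subgroup[OF nN] subgroup.subset by blast
    ultimately show ?thesis
      using g_one_iff by blast
  qed
  have g_inj: "\<phi> \<in> N" if \<phi>: "\<phi> \<in> carrier \<Gamma>" and "?g \<phi> = \<one>\<^bsub>Utw G A n\<^esub>" for \<phi>
  proof -
    have "pull \<phi> \<in> coboundaries G A n"
      using that g_one_iff by blast
    then obtain \<psi> where \<psi>: "\<psi> \<in> carrier (cochains G A ?m)" "pull \<phi> = coboundary G ?m \<psi>"
      using n by (auto simp: coboundaries_def split: if_splits)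
    have "\<phi> (bar_boundary G n c) = \<psi> (bar_boundary G n c)" if "c \<in> carrier (bar_chains G n)" for c
      using fun_cong[OF \<psi>(2), of c] that n by (simp add: pull_def coboundary_def)
    then have eq: "\<phi> b = \<psi> b" if "b \<in> B" for b
      using that by (auto simp: B_eq)
    have "(\<lambda>x. x) \<in> hom P (bar_chains G ?m)"
      by (auto simp: hom_def P_def cycles_chains)
    from pullback_in_hom_group[OF P.is_group this, of \<psi> A]
    have "restrict \<psi> (carrier P) \<in> carrier (hom_group P A)"
      using \<psi>(1) by (simp add: cochains_def)
    moreover have "\<phi> = restrict (restrict \<psi> (carrier P)) B"
    proof (rule extensionalityI[of _ B])
      show "\<phi> \<in> extensional B"
        using \<phi> by (simp add: \<Gamma>_def carrier_hom_group)
      show "\<phi> b = restrict (restrict \<psi> (carrier P)) B b" if "b \<in> B" for b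
        using that eq subgroup.subset[OF B] by auto
    qed (rule restrict_extensional)
    ultimately show ?thesis
      unfolding N_def using restrict_in_res_image[of "restrict \<psi> (carrier P)" P A B] by (simp only:)
  qed
  show "iota_coker G A n \<in> mon Q (Utw G A n)"
    unfolding iota Q by (rule FactGroup_induced_mon[OF \<Gamma>.is_group U.is_group nN g g_N g_inj])

  obtain s where "s \<in> hom ((bar_chains G ?m)\<lparr>carrier := bar_boundary G n ` carrier (bar_chains G n)\<rparr>)
      (bar_chains G n)"
    and \<pi>: "(\<lambda>c. c - s (bar_boundary G n c)) \<in> hom (bar_chains G n) (cycle_group G n)"
    by (rule boundary_splitting[of n]) (rule that)
  then have s: "s \<in> hom (P\<lparr>carrier := B\<rparr>) (bar_chains G n)"
    unfolding PB unfolding B_eq by blast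
  have "iota_coker G A n ` carrier Q = ?g ` carrier \<Gamma>"
    unfolding iota Q by (rule FactGroup_induced_image[OF \<Gamma>.is_group U.is_group nN g g_N])
  also have "\<dots> = kernel (Utw G A n) (hom_group (H0n G n) A) (rho_tilde G n)"
  proof
    show "?g ` carrier \<Gamma> \<subseteq> kernel (Utw G A n) (hom_group (H0n G n) A) (rho_tilde G n)"
      using pull_Utw pull_cycles rho_tilde_eq_one_iff[OF n] by (auto simp: kernel_def carrier_Utw)
    show "kernel (Utw G A n) (hom_group (H0n G n) A) (rho_tilde G n) \<subseteq> ?g ` carrier \<Gamma>"
    proof
      fix X assume "X \<in> kernel (Utw G A n) (hom_group (H0n G n) A) (rho_tilde G n)"
      then obtain \<omega> where \<omega>: "\<omega> \<in> Utw_cocycles n" "X = cohomology_class G A n \<omega>"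
        and van: "\<And>z. z \<in> bar_cycles G n \<Longrightarrow> \<omega> z = \<one>\<^bsub>A\<^esub>"
        using rho_tilde_eq_one_iff[OF n] by (auto simp: kernel_def carrier_Utw)
      have \<omega>_co: "\<omega> \<in> carrier (cochains G A n)"
        by (rule Utw_cocycles_cochains[OF \<omega>(1)])
      let ?\<phi> = "\<lambda>b\<in>B. \<omega> (s b)"
      have \<phi>: "?\<phi> \<in> carrier \<Gamma>"
        using pullback_in_hom_group[OF PBg s, of \<omega> A] \<omega>_co by (simp add: \<Gamma>_def cochains_def)
      have "pull ?\<phi> = \<omega>"
      proof (rule hom_group_eqI[of _ "bar_chains G n" A])
        show "pull ?\<phi> \<in> carrier (hom_group (bar_chains G n) A)" "\<omega> \<in> carrier (hom_group (bar_chains G n) A)"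
          using hom_in_carrier[OF pull \<phi>] \<omega>_co by (simp_all add: cochains_def)
        fix c assume c: "c \<in> carrier (bar_chains G n)"
        let ?b = "bar_boundary G n c"
        have b: "?b \<in> B"
          using c by (simp add: B_eq)
        have sb: "s ?b \<in> carrier (bar_chains G n)"
          using hom_in_carrier[OF s] b by simp
        have z: "c - s ?b \<in> bar_cycles G n"
          using hom_in_carrier[OF \<pi> c] by simp
        have "\<omega> c = \<omega> ((c - s ?b) + s ?b)"
          by simp
        also have "\<dots> = \<omega> (s ?b)"
          using cochain_add[OF \<omega>_co cycles_chains[OF z] sb] van[OF z] cochain_closed[OF \<omega>_co sb] by simp
        finally show "pull ?\<phi> c = \<omega> c"
          using b c by (simp add: pull_def)
      qed
      then show "X \<in> ?g ` carrier \<Gamma>"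
        using \<phi> \<omega>(2) by (intro image_eqI[of _ _ ?\<phi>]) simp_all
    qed
  qed
  finally show "iota_coker G A n ` carrier Q = kernel (Utw G A n) (hom_group (H0n G n) A) (rho_tilde G n)" .
qed

text \<open>The cycles are a subgroup of a free abelian group, so the lift required by \<open>Ext1_ident_iso\<close> exists.\<close>

lemma Ext1_ident_bar:
  "Ext1_ident (cycle_group G m) (bar_boundaries G m) A
    \<in> iso (Ext1 (group_homology G m) A) (res_coker (cycle_group G m) (bar_boundaries G m) A)"
  unfolding group_homology_def
proof (rule Ext1_ident_iso[OF comm_group_cycle_group _ A.comm_group_axioms])
  interpret Z: comm_group "cycle_group G m"
    by (rule comm_group_cycle_group)
  show B: "subgroup (bar_boundaries G m) (cycle_group G m)"
    by (rule subgroup_boundaries_cycle_group)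
  interpret B: normal "bar_boundaries G m" "cycle_group G m"
    by (rule Z.subgroup_imp_normal[OF B])
  let ?M = "cycle_group G m Mod bar_boundaries G m"
  have M: "comm_group ?M"
    by (rule Z.abelian_FactGroup[OF B])
  have "(\<lambda>z. bar_boundaries G m #>\<^bsub>cycle_group G m\<^esub> z) ` bar_cycles G m
      \<subseteq> free_eval ?M ` carrier (free_Abelian_group (carrier ?M))"
  proof
    fix X assume "X \<in> (\<lambda>z. bar_boundaries G m #>\<^bsub>cycle_group G m\<^esub> z) ` bar_cycles G m"
    then have X: "X \<in> carrier ?M"
      by (simp add: carrier_FactGroup)
    then show "X \<in> free_eval ?M ` carrier (free_Abelian_group (carrier ?M))"
      by (intro image_eqI[of _ _ "frag_of X"]) (simp_all add: free_eval_frag_of[OF M])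
  qed
  then show "\<exists>t. t \<in> hom (cycle_group G m) (free_Abelian_group (carrier ?M)) \<and>
      (\<forall>x\<in>carrier (cycle_group G m). free_eval ?M (t x) = bar_boundaries G m #>\<^bsub>cycle_group G m\<^esub> x)"
    using cycle_group_projective[OF abelian_free_Abelian_group comm_group.axioms(2)[OF M]
        free_eval_hom[OF M] B.r_coset_hom_Mod] unfolding carrier_cycle_group by metis
qed

end

theorem theorem4p1:
  fixes G :: "('g, 'm) monoid_scheme" and A :: "('a, 'k) monoid_scheme" and n :: nat
  assumes "group G" and "comm_group A" and "n \<ge> 1"
  shows "short_exact (Ext1 (group_homology G (n - 1)) A) (Utw G A n) (hom_group (H0n G n) A)
           (iota G A n) (rho_tilde G n)
         \<and> has_section (Utw G A n) (hom_group (H0n G n) A) (rho_tilde G n)"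
proof -
  interpret bar_cochains G A
    by (rule bar_cochains.intro) fact+
  note n = \<open>n \<ge> 1\<close>
  let ?M = "group_homology G (n - 1)"
  let ?Q = "res_coker (cycle_group G (n - 1)) (bar_boundaries G (n - 1)) A"
  have splits: "has_section (Utw G A n) (hom_group (H0n G n) A) (rho_tilde G n)"
    by (rule rho_tilde_has_section[OF n])
  have Ext: "comm_group (Ext1 ?M A)"
    by (rule comm_group_Ext1[OF comm_group_group_homology assms(2)])
  have Hom: "comm_group (hom_group (H0n G n) A)"
    by (rule comm_group_hom_group[OF comm_group.axioms(2)[OF comm_group_H0n[OF n]] assms(2)])
  have iso: "Ext1_ident (cycle_group G (n - 1)) (bar_boundaries G (n - 1)) A \<in> iso (Ext1 ?M A) ?Q"
    by (rule Ext1_ident_bar)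
  then have bij: "bij_betw (Ext1_ident (cycle_group G (n - 1)) (bar_boundaries G (n - 1)) A)
      (carrier (Ext1 ?M A)) (carrier ?Q)"
    by (simp add: iso_def)
  have "iota G A n \<in> hom (Ext1 ?M A) (Utw G A n)"
    unfolding iota_def
    by (rule hom_compose[of _ _ ?Q]) (use iso iota_coker_exact(1)[OF n] in \<open>simp_all add: iso_def mon_def\<close>)
  moreover have "inj_on (iota G A n) (carrier (Ext1 ?M A))"
    unfolding iota_def
    by (rule comp_inj_on) (use bij iota_coker_exact(1)[OF n] in \<open>simp_all add: bij_betw_def mon_def\<close>)
  ultimately have "iota G A n \<in> mon (Ext1 ?M A) (Utw G A n)"
    by (simp add: mon_def)
  moreover have "iota G A n ` carrier (Ext1 ?M A) = kernel (Utw G A n) (hom_group (H0n G n) A) (rho_tilde G n)"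
    using bij iota_coker_exact(2)[OF n] unfolding iota_def bij_betw_def by (metis image_comp)
  moreover have "rho_tilde G n \<in> epi (Utw G A n) (hom_group (H0n G n) A)"
  proof -
    obtain s where s: "s \<in> hom (hom_group (H0n G n) A) (Utw G A n)"
      and s_id: "\<And>f. f \<in> carrier (hom_group (H0n G n) A) \<Longrightarrow> rho_tilde G n (s f) = f"
      using splits by (auto simp: has_section_def)
    have "f \<in> rho_tilde G n ` carrier (Utw G A n)" if "f \<in> carrier (hom_group (H0n G n) A)" for f
      using s_id[OF that] hom_in_carrier[OF s that] by (metis image_eqI)
    then show ?thesis
      using rho_tilde_hom[OF n] rho_tilde_in_hom_group[OF n] unfolding epi_def by blast
  qed
  ultimately show ?thesis
    using splits Ext Hom comm_group_Utw[OF n] by (simp add: short_exact_def)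
qed

end
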